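(* Let $X$ be an infinite-dimensional complex Banach space, $T \in \mathcal{B}(X)$, and $F \in \mathcal{B}(X)$ with $F^{n}$ of finite rank for some $n \in \mathbb{N}$. If $T$ commutes with $F$, then (1) $\sigma_{USBW}(T+F)=\sigma_{USBW}(T)$; (2) $\sigma_{LSBW}(T+F)=\sigma_{LSBW}(T)$; (3) $\sigma_{SBW}(T+F)=\sigma_{SBW}(T)$; (4) $\sigma_{BW}(T+F)=\sigma_{BW}(T)$.
   Context: $\mathcal{B}(X)$ is the algebra of bounded linear operators on $X$. An operator $S$ is upper (resp. lower) semi-Fredholm if $\mathcal{R}(S)$ is closed and $\dim\mathcal{N}(S)<\infty$ (resp. $\operatorname{codim}\mathcal{R}(S)<\infty$), Fredholm if both, with index $\operatorname{ind}(S)=\dim\mathcal{N}(S)-\operatorname{codim}\mathcal{R}(S)$. $S_n$ is the restriction of $S$ to $\mathcal{R}(S^n)$ viewed as a map $\mathcal{R}(S^n)\to\mathcal{R}(S^n)$. $S$ is upper semi-B-Fredholm (resp. lower semi-B-Fredholm, B-Fredholm) if there is $n$ with $\mathcal{R}(S^n)$ closed and $S_n$ upper semi-Fredholm (resp. lower semi-Fredholm, Fredholm); the index $\operatorname{ind}(S):=\operatorname{ind}(S_n)$ for such $n$ (independent of $n$). $S$ is B-Weyl if B-Fredholm with index $0$; upper semi-B-Weyl if upper semi-B-Fredholm with index $\le0$; lower semi-B-Weyl if lower semi-B-Fredholm with index $\ge0$; semi-B-Weyl if upper or lower semi-B-Weyl. $\sigma_{USBW}(T)$, $\sigma_{LSBW}(T)$,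 $\sigma_{SBW}(T)$, $\sigma_{BW}(T)$ are the sets of $\lambda\in\mathbb{C}$ with $T-\lambda I$ not upper semi-B-Weyl, not lower semi-B-Weyl, not semi-B-Weyl, not B-Weyl, respectively. *)

theory Defs
  imports "HOL-Analysis.Analysis"
begin

section \<open>Complex Banach spaces\<close>

class scaleC =
  fixes scaleC :: "complex \<Rightarrow> 'a \<Rightarrow> 'a" (infixr \<open>*\<^sub>C\<close> 75)

class complex_vector = real_vector + scaleC +
  assumes scaleC_add_right: "a *\<^sub>C (x + y) = a *\<^sub>C x + a *\<^sub>C y"
    and scaleC_add_left: "(a + b) *\<^sub>C x = a *\<^sub>C x + b *\<^sub>C x"
    and scaleC_scaleC: "a *\<^sub>C (b *\<^sub>C x) = (a * b) *\<^sub>C x"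
    and scaleC_one: "1 *\<^sub>C x = x"
    and scaleR_scaleC: "r *\<^sub>R x = complex_of_real r *\<^sub>C x"

class complex_normed_vector = complex_vector + real_normed_vector +
  assumes norm_scaleC: "norm (a *\<^sub>C x) = cmod a * norm x"

class complex_banach = complex_normed_vector + banach

interpretation cvs: vector_space "scaleC :: complex \<Rightarrow> 'a::complex_vector \<Rightarrow> 'a"
  by unfold_locales (simp_all add: scaleC_add_right scaleC_add_left scaleC_scaleC scaleC_one)

instantiation complex :: complex_banach
begin
definition scaleC_complex_def: "scaleC (a::complex) (x::complex) = a * x"
instance
  by standard (auto simp: scaleC_complex_def algebra_simps norm_mult scaleR_conv_of_real)
end

section \<open>Bounded operators, dimension, codimension\<close>

text \<open>Bounded (complex-)linear operators on X.\<close>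
definition bounded_clinear_op :: "('a::complex_normed_vector \<Rightarrow> 'a) \<Rightarrow> bool" where
  "bounded_clinear_op S \<longleftrightarrow> Vector_Spaces.linear (*\<^sub>C) (*\<^sub>C) S \<and> bounded_linear S"

text \<open>A set is finite-dimensional (over C) if it lies in the complex span of a finite set.\<close>
definition cfinite_dim :: "'a::complex_vector set \<Rightarrow> bool" where
  "cfinite_dim V \<longleftrightarrow> (\<exists>B. finite B \<and> V \<subseteq> cvs.span B)"

text \<open>Dimension as an extended natural number.\<close>
definition edim :: "'a::complex_vector set \<Rightarrow> enat" where
  "edim V = (if cfinite_dim V then enat (cvs.dim V) else \<infinity>)"

text \<open>Codimension of W in V (W a subspace of V): the least number of vectors of V
  which together with W span V, i.e. dim (V/W); infinity if no finite such set exists.\<close>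
definition ecodim :: "'a::complex_vector set \<Rightarrow> 'a set \<Rightarrow> enat" where
  "ecodim V W = (if \<exists>F. finite F \<and> F \<subseteq> V \<and> V \<subseteq> cvs.span (W \<union> F)
     then enat (LEAST n. \<exists>F. finite F \<and> card F = n \<and> F \<subseteq> V \<and> V \<subseteq> cvs.span (W \<union> F))
     else \<infinity>)"

definition null_space :: "('a::complex_vector \<Rightarrow> 'a) \<Rightarrow> 'a set" where
  "null_space S = {x. S x = 0}"

section \<open>(Semi-)Fredholm properties of the restriction of S to an invariant subspace M\<close>

text \<open>S_M : M \<rightarrow> M, the restriction of S to M (M closed and S-invariant).
  Its null space is N(S) \<inter> M, its range is S ` M.\<close>

definition upper_sf_on :: "'a::complex_normed_vector set \<Rightarrow> ('a \<Rightarrow> 'a) \<Rightarrow> bool" where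
  "upper_sf_on M S \<longleftrightarrow> closed (S ` M) \<and> edim (null_space S \<inter> M) < \<infinity>"

definition lower_sf_on :: "'a::complex_normed_vector set \<Rightarrow> ('a \<Rightarrow> 'a) \<Rightarrow> bool" where
  "lower_sf_on M S \<longleftrightarrow> closed (S ` M) \<and> ecodim M (S ` M) < \<infinity>"

definition fredholm_on :: "'a::complex_normed_vector set \<Rightarrow> ('a \<Rightarrow> 'a) \<Rightarrow> bool" where
  "fredholm_on M S \<longleftrightarrow> upper_sf_on M S \<and> lower_sf_on M S"

text \<open>Index, with values in the extended reals (it is \<open>-\<infinity>\<close> / \<open>+\<infinity>\<close> for properly
  upper / lower semi-Fredholm operators).\<close>
definition index_on :: "'a::complex_normed_vector set \<Rightarrow> ('a \<Rightarrow> 'a) \<Rightarrow> ereal" where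
  "index_on M S = ereal_of_enat (edim (null_space S \<inter> M)) - ereal_of_enat (ecodim M (S ` M))"

section \<open>Semi-B-Fredholm and semi-B-Weyl operators\<close>

text \<open>\<open>S_n\<close> is the restriction of S to \<open>R(S^n) = range (S ^^ n)\<close>.\<close>

definition upper_semi_B_weyl :: "('a::complex_normed_vector \<Rightarrow> 'a) \<Rightarrow> bool" where
  "upper_semi_B_weyl S \<longleftrightarrow> (\<exists>n. closed (range (S ^^ n)) \<and> upper_sf_on (range (S ^^ n)) S
      \<and> index_on (range (S ^^ n)) S \<le> 0)"

definition lower_semi_B_weyl :: "('a::complex_normed_vector \<Rightarrow> 'a) \<Rightarrow> bool" where
  "lower_semi_B_weyl S \<longleftrightarrow> (\<exists>n. closed (range (S ^^ n)) \<and> lower_sf_on (range (S ^^ n)) S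
      \<and> index_on (range (S ^^ n)) S \<ge> 0)"

definition semi_B_weyl :: "('a::complex_normed_vector \<Rightarrow> 'a) \<Rightarrow> bool" where
  "semi_B_weyl S \<longleftrightarrow> upper_semi_B_weyl S \<or> lower_semi_B_weyl S"

definition B_weyl :: "('a::complex_normed_vector \<Rightarrow> 'a) \<Rightarrow> bool" where
  "B_weyl S \<longleftrightarrow> (\<exists>n. closed (range (S ^^ n)) \<and> fredholm_on (range (S ^^ n)) S
      \<and> index_on (range (S ^^ n)) S = 0)"

section \<open>Spectra\<close>

definition shift_op :: "('a::complex_vector \<Rightarrow> 'a) \<Rightarrow> complex \<Rightarrow> 'a \<Rightarrow> 'a" where
  "shift_op T c = (\<lambda>x. T x - c *\<^sub>C x)"

definition sigma_USBW :: "('a::complex_normed_vector \<Rightarrow> 'a) \<Rightarrow> complex set" where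
  "sigma_USBW T = {c. \<not> upper_semi_B_weyl (shift_op T c)}"

definition sigma_LSBW :: "('a::complex_normed_vector \<Rightarrow> 'a) \<Rightarrow> complex set" where
  "sigma_LSBW T = {c. \<not> lower_semi_B_weyl (shift_op T c)}"

definition sigma_SBW :: "('a::complex_normed_vector \<Rightarrow> 'a) \<Rightarrow> complex set" where
  "sigma_SBW T = {c. \<not> semi_B_weyl (shift_op T c)}"

definition sigma_BW :: "('a::complex_normed_vector \<Rightarrow> 'a) \<Rightarrow> complex set" where
  "sigma_BW T = {c. \<not> B_weyl (shift_op T c)}"

end

theory Submission
  imports Defs
begin

text \<open>
  Put \<open>S = T - c\<close>, \<open>U = S + F\<close>, and let the range of \<open>F ^ m\<close> lie in a finite-dimensional space \<open>E\<close>.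
  Write \<open>a_n(S) = dim (N(S) \<inter> R(S^n))\<close> and \<open>b_n(S) = dim (R(S^n) / R(S^(n+1)))\<close>. Both sequences
  decrease, and in passing from \<open>n\<close> to \<open>n + 1\<close> they drop by the same amount, so the sign conditions on
  the index can be read off their limits \<open>a(S)\<close> and \<open>b(S)\<close>.

  Commutativity gives \<open>R(U^(d+m)) \<subseteq> R(S^d) + E\<close> and \<open>S^(k+m) N(U^k) \<subseteq> E\<close>. As \<open>N(S^k) \<inter> R(S^d)\<close> has
  dimension \<open>a_d(S) + \<dots> + a_(d+k-1)(S)\<close>, and similarly for \<open>b\<close>, this yields
  \<open>k a(U) \<le> (k + m) a_d(S) + O(1)\<close> for all \<open>k\<close>, hence \<open>a(U) \<le> a(S)\<close>; likewise for \<open>b\<close>, and equality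
  follows from the symmetry \<open>S = U + (- F)\<close>.

  It remains to see that \<open>R(U^c)\<close> is closed for large \<open>c\<close>. If some \<open>b_n(S)\<close> is finite, \<open>R(U^c)\<close> agrees with
  the closed space \<open>R(S^n)\<close> up to finite dimensions. If \<open>a_n(S)\<close> is finite, then
  \<open>V U = S^m - (- F)^m\<close> for some bounded \<open>V\<close>, so \<open>U\<close> is upper semi-Fredholm on \<open>R(S^n)\<close>; therefore
  \<open>S^n R(U^c) = U^c R(S^n)\<close> is closed, and so is its preimage under \<open>S^n\<close>, which inside \<open>R(S^n) + E\<close>
  is \<open>R(U^c)\<close> plus a finite-dimensional space. In both cases one uses that an operator range
  is closed as soon as its sum with some finite-dimensional space is.
\<close>

section \<open>Relative dimension\<close>

interpretation cvs_pair: vector_space_pair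
  "scaleC :: complex \<Rightarrow> 'a::complex_vector \<Rightarrow> 'a" "scaleC :: complex \<Rightarrow> 'b::complex_vector \<Rightarrow> 'b"
  by unfold_locales

abbreviation clinear :: "('a::complex_vector \<Rightarrow> 'b::complex_vector) \<Rightarrow> bool" where
  "clinear \<equiv> Vector_Spaces.linear (*\<^sub>C) (*\<^sub>C)"

text \<open>For subspaces this is the dimension of \<open>(V + W) / W\<close>. Neither
  \<open>W\<close> nor the spanning vectors have to lie in \<open>V\<close>, so spaces that agree
  only up to finite dimension can be compared, and in the triangle inequality witnesses simply
  unite. An empty family of witnesses gives \<open>\<infinity>\<close>.\<close>

definition reldim :: "'a::complex_vector set \<Rightarrow> 'a set \<Rightarrow> enat" where
  "reldim V W = (INF F\<in>{F. finite F \<and> V \<subseteq> cvs.span (W \<union> F)}. enat (card F))"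

lemma reldim_le_card:
  assumes "finite F" "V \<subseteq> cvs.span (W \<union> F)"
  shows "reldim V W \<le> enat (card F)"
  unfolding reldim_def using assms by (intro INF_lower) auto

lemma reldim_witness:
  assumes "reldim V W \<noteq> \<infinity>"
  obtains F where "finite F" "V \<subseteq> cvs.span (W \<union> F)" "reldim V W = enat (card F)"
proof -
  let ?A = "(\<lambda>F. enat (card F)) ` {F. finite F \<and> V \<subseteq> cvs.span (W \<union> F)}"
  have "?A \<noteq> {}"
    using assms unfolding reldim_def by (metis Inf_empty top_enat_def)
  then have "Inf ?A \<in> ?A"
    unfolding Inf_enat_def by (auto intro: LeastI)
  with that show thesis
    unfolding reldim_def by auto
qed

lemma reldim_mono: "V' \<subseteq> V \<Longrightarrow> W \<subseteq> W' \<Longrightarrow> reldim V' W' \<le> reldim V W"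
proof -
  assume "V' \<subseteq> V" "W \<subseteq> W'"
  then have "V' \<subseteq> cvs.span (W' \<union> F)" if "V \<subseteq> cvs.span (W \<union> F)" for F
    using that cvs.span_mono[of "W \<union> F" "W' \<union> F"] by auto
  then show ?thesis
    unfolding reldim_def by (intro INF_superset_mono) auto
qed

lemma reldim_triangle: "reldim V Z \<le> reldim V W + reldim W Z"
proof (cases "reldim V W = \<infinity> \<or> reldim W Z = \<infinity>")
  case False
  then obtain F G where F: "finite F" "V \<subseteq> cvs.span (W \<union> F)" "reldim V W = enat (card F)"
    and G: "finite G" "W \<subseteq> cvs.span (Z \<union> G)" "reldim W Z = enat (card G)"
    by (metis reldim_witness)
  have "cvs.span (W \<union> F) \<subseteq> cvs.span (Z \<union> (F \<union> G))"
  proof (rule cvs.span_minimal)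
    have "W \<subseteq> cvs.span (Z \<union> (F \<union> G))"
      using G(2) cvs.span_mono[of "Z \<union> G" "Z \<union> (F \<union> G)"] by auto
    then show "W \<union> F \<subseteq> cvs.span (Z \<union> (F \<union> G))"
      by (auto intro: cvs.span_base)
  qed auto
  then have "reldim V Z \<le> enat (card (F \<union> G))"
    using F G by (intro reldim_le_card) auto
  also have "\<dots> \<le> enat (card F + card G)"
    by (simp add: card_Un_le)
  finally show ?thesis
    using F G by simp
qed auto

lemma reldim_eq_0: "V \<subseteq> cvs.span W \<Longrightarrow> reldim V W = 0"
  using reldim_le_card[of "{}" V W] by (simp add: zero_enat_def[symmetric])

lemma reldim_span_right [simp]: "reldim V (cvs.span W) = reldim V W"
proof (rule antisym)
  show "reldim V (cvs.span W) \<le> reldim V W"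
    by (rule reldim_mono) (auto simp: cvs.span_base)
  show "reldim V W \<le> reldim V (cvs.span W)"
    using reldim_triangle[of V W "cvs.span W"] reldim_eq_0[of "cvs.span W" W] by auto
qed

lemma reldim_Un_le: "finite F \<Longrightarrow> reldim V W \<le> reldim V (W \<union> F) + enat (card F)"
  by (rule order_trans[OF reldim_triangle[of V W "W \<union> F"]])
     (auto intro!: add_left_mono reldim_le_card intro: cvs.span_base)

lemma span_insert_subspace:
  "cvs.subspace W \<Longrightarrow> x \<in> cvs.span (insert h W) \<longleftrightarrow> (\<exists>c. x - c *\<^sub>C h \<in> W)"
  by (metis cvs.span_breakdown_eq cvs.span_eq_iff)

text \<open>The vectors of \<open>H\<close> are exchanged for vectors of \<open>V\<close> without
  increasing their number. After the induction hypothesis for \<open>W1 = W + span {h}\<close>,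
  either \<open>V\<close> meets \<open>W1\<close> only inside \<open>W\<close>, or some
  \<open>v\<close> in \<open>V\<close> has a nonzero component along \<open>h\<close> modulo
  \<open>W\<close> and takes the place of \<open>h\<close>.\<close>

lemma reldim_inside_aux:
  assumes "finite H" "cvs.subspace V" "cvs.subspace W" "V \<subseteq> cvs.span (W \<union> H)"
  shows "\<exists>H'. finite H' \<and> H' \<subseteq> V \<and> card H' \<le> card H \<and> V \<subseteq> cvs.span ((V \<inter> W) \<union> H')"
  using assms
proof (induction H arbitrary: W rule: finite_induct)
  case empty
  then have "V \<subseteq> cvs.span (V \<inter> W)"
    by (metis cvs.span_eq_iff inf.absorb1 order_refl sup_bot_right)
  then show ?case
    by (intro exI[of _ "{}"]) auto
next
  case (insert h H)
  define W1 where "W1 = cvs.span (insert h W)"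
  have "W \<union> insert h H \<subseteq> cvs.span (W1 \<union> H)"
    unfolding W1_def by (auto intro: cvs.span_base)
  then have "V \<subseteq> cvs.span (W1 \<union> H)"
    by (rule order_trans[OF insert.prems(3) cvs.span_minimal[OF _ cvs.subspace_span]])
  then obtain H' where H': "finite H'" "H' \<subseteq> V" "card H' \<le> card H" "V \<subseteq> cvs.span ((V \<inter> W1) \<union> H')"
    using insert.IH[of W1] insert.prems(1) unfolding W1_def by (metis cvs.subspace_span)
  show ?case
  proof (cases "V \<inter> W1 \<subseteq> W")
    case True
    then have "V \<inter> W1 \<union> H' \<subseteq> V \<inter> W \<union> H'"
      by auto
    then have "V \<subseteq> cvs.span (V \<inter> W \<union> H')"
      by (rule order_trans[OF H'(4) cvs.span_mono])
    then show ?thesis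
      using H' insert.hyps by (intro exI[of _ H']) auto
  next
    case False
    then obtain v where v: "v \<in> V" "v \<in> W1" "v \<notin> W" by auto
    obtain c where c: "v - c *\<^sub>C h \<in> W"
      using v(2) insert.prems(2) unfolding W1_def
      by (auto simp: span_insert_subspace)
    have "c \<noteq> 0"
      using c v(3) by auto
    have "V \<inter> W1 \<subseteq> cvs.span (V \<inter> W \<union> insert v H')"
    proof
      fix u assume u: "u \<in> V \<inter> W1"
      obtain d where d: "u - d *\<^sub>C h \<in> W"
        using u insert.prems(2) unfolding W1_def
        by (auto simp: span_insert_subspace)
      have "u - (d / c) *\<^sub>C v = (u - d *\<^sub>C h) - (d / c) *\<^sub>C (v - c *\<^sub>C h)"
        using \<open>c \<noteq> 0\<close> by (simp add: cvs.scale_right_diff_distrib scaleC_scaleC)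
      also have "\<dots> \<in> W"
        by (rule cvs.subspace_diff[OF insert.prems(2) d cvs.subspace_scale[OF insert.prems(2) c]])
      finally have "u - (d / c) *\<^sub>C v \<in> W" .
      moreover have "u - (d / c) *\<^sub>C v \<in> V"
        using u v(1) cvs.subspace_diff[OF insert.prems(1) _ cvs.subspace_scale[OF insert.prems(1)]] by blast
      ultimately have "u - (d / c) *\<^sub>C v \<in> cvs.span (V \<inter> W \<union> insert v H')"
        by (auto intro: cvs.span_base)
      moreover have "(d / c) *\<^sub>C v \<in> cvs.span (V \<inter> W \<union> insert v H')"
        by (intro cvs.span_scale cvs.span_base) auto
      ultimately show "u \<in> cvs.span (V \<inter> W \<union> insert v H')"
        using cvs.span_add by fastforce
    qed
    then have "V \<inter> W1 \<union> H' \<subseteq> cvs.span (V \<inter> W \<union> insert v H')"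
      by (auto intro: cvs.span_base)
    then have "V \<subseteq> cvs.span (V \<inter> W \<union> insert v H')"
      by (rule order_trans[OF H'(4) cvs.span_minimal[OF _ cvs.subspace_span]])
    moreover have "card (insert v H') \<le> card (insert h H)"
      using H' insert.hyps by (simp add: card_insert_if)
    ultimately show ?thesis
      using H' v by (intro exI[of _ "insert v H'"]) auto
  qed
qed

lemma reldim_inside:
  assumes "cvs.subspace V" "cvs.subspace W" "reldim V W \<noteq> \<infinity>"
  obtains H where "finite H" "H \<subseteq> V" "V \<subseteq> cvs.span ((V \<inter> W) \<union> H)" "reldim V W = enat (card H)"
proof -
  obtain F where F: "finite F" "V \<subseteq> cvs.span (W \<union> F)" "reldim V W = enat (card F)"
    using assms(3) reldim_witness by blast
  obtain H where H: "finite H" "H \<subseteq> V" "card H \<le> card F" "V \<subseteq> cvs.span ((V \<inter> W) \<union> H)"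
    using reldim_inside_aux[OF F(1) assms(1,2) F(2)] by blast
  have "V \<inter> W \<union> H \<subseteq> W \<union> H"
    by auto
  then have "V \<subseteq> cvs.span (W \<union> H)"
    by (rule order_trans[OF H(4) cvs.span_mono])
  then have "enat (card F) \<le> enat (card H)"
    using reldim_le_card[OF H(1)] F(3) by metis
  with H F that show thesis
    by simp
qed

lemma reldim_Int:
  assumes "cvs.subspace V" "cvs.subspace W"
  shows "reldim V (V \<inter> W) = reldim V W"
proof (cases "reldim V W = \<infinity>")
  case True
  then show ?thesis
    using reldim_mono[of V V "V \<inter> W" W] by auto
next
  case False
  then show ?thesis
    using reldim_inside[OF assms] reldim_le_card reldim_mono[of V V "V \<inter> W" W]
    by (metis Int_lower2 antisym order_refl)
qed

text \<open>Induction on \<open>F\<close>, adjoining \<open>e\<close> to all three spaces. If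
  \<open>e\<close> lies in \<open>W\<close>, only the dimension of \<open>W\<close> over
  \<open>Z\<close> can drop, and by at most one; otherwise \<open>W\<close> meets
  \<open>Z + span {e}\<close> only in \<open>Z\<close>, and only the dimension of \<open>V\<close>
  over \<open>W\<close> can drop.\<close>

lemma reldim_superadditive_aux:
  assumes "finite F" "cvs.subspace V" "cvs.subspace W" "cvs.subspace Z" "Z \<subseteq> W" "W \<subseteq> V"
    "V \<subseteq> cvs.span (Z \<union> F)"
  shows "reldim V W + reldim W Z \<le> enat (card F)"
  using assms
proof (induction F arbitrary: V W Z rule: finite_induct)
  case empty
  then have "V \<subseteq> Z"
    by (metis cvs.span_eq_iff sup_bot_right)
  then show ?case
    using empty cvs.span_superset[of W] cvs.span_superset[of Z]
    by (auto simp: reldim_eq_0 zero_enat_def[symmetric])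
next
  case (insert e G)
  let ?V = "cvs.span (insert e V)" and ?W = "cvs.span (insert e W)" and ?Z = "cvs.span (insert e Z)"
  have "insert e V \<subseteq> cvs.span (?Z \<union> G)"
  proof -
    have "Z \<union> insert e G \<subseteq> cvs.span (?Z \<union> G)"
      by (auto intro: cvs.span_base)
    then have "V \<subseteq> cvs.span (?Z \<union> G)"
      by (rule order_trans[OF insert.prems(6) cvs.span_minimal[OF _ cvs.subspace_span]])
    then show ?thesis
      by (auto intro: cvs.span_base)
  qed
  then have "?V \<subseteq> cvs.span (?Z \<union> G)"
    by (simp add: cvs.span_minimal)
  then have IH: "reldim ?V ?W + reldim ?W ?Z \<le> enat (card G)"
    by (rule insert.IH[OF cvs.subspace_span cvs.subspace_span cvs.subspace_span
          cvs.span_mono[OF insert_mono[OF insert.prems(4)]] cvs.span_mono[OF insert_mono[OF insert.prems(5)]]])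
  have card: "enat (card (insert e G)) = enat (card G) + 1"
    using insert.hyps by (simp add: one_enat_def)
  have incV: "V \<subseteq> ?V" and incW: "W \<subseteq> ?W"
    by (auto intro: cvs.span_base)
  have step: "reldim A B \<le> reldim (cvs.span (insert e A)) (cvs.span (insert e B)) + 1" for A B
  proof -
    have "reldim A B \<le> reldim A (B \<union> {e}) + enat (card {e})"
      by (rule reldim_Un_le) simp
    also have "\<dots> = reldim A (cvs.span (insert e B)) + 1"
      by (simp add: one_enat_def)
    also have "\<dots> \<le> reldim (cvs.span (insert e A)) (cvs.span (insert e B)) + 1"
      by (intro add_right_mono reldim_mono) (auto intro: cvs.span_base)
    finally show ?thesis .
  qed
  show ?case
  proof (cases "e \<in> W")
    case True
    then have "reldim V W \<le> reldim ?V ?W"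
      using insert.prems(2) reldim_mono[OF incV order_refl]
      by (metis cvs.span_eq_iff insert_absorb)
    moreover have "reldim W Z \<le> reldim ?W ?Z + 1"
      by (rule step)
    ultimately have "reldim V W + reldim W Z \<le> (reldim ?V ?W + reldim ?W ?Z) + 1"
      unfolding add.assoc by (rule add_mono)
    also have "\<dots> \<le> enat (card G) + 1"
      using IH by (rule add_right_mono)
    finally show ?thesis
      using card by simp
  next
    case False
    have "W \<inter> ?Z \<subseteq> Z"
    proof
      fix x assume x: "x \<in> W \<inter> ?Z"
      then obtain c where c: "x - c *\<^sub>C e \<in> Z"
        using insert.prems(3) by (auto simp: span_insert_subspace)
      then have "x - (x - c *\<^sub>C e) \<in> W"
        using x insert.prems(4) cvs.subspace_diff[OF insert.prems(2)] by blast
      then have "c *\<^sub>C e \<in> W"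
        by simp
      then have "c = 0"
        using False insert.prems(2) cvs.subspace_scale[of W "c *\<^sub>C e" "inverse c"]
        by (cases "c = 0") (auto simp: scaleC_scaleC)
      with c show "x \<in> Z"
        by simp
    qed
    then have "reldim W Z \<le> reldim W (W \<inter> ?Z)"
      by (intro reldim_mono) auto
    also have "\<dots> = reldim W ?Z"
      by (rule reldim_Int) (use insert.prems in auto)
    also have "\<dots> \<le> reldim ?W ?Z"
      by (rule reldim_mono[OF incW order_refl])
    finally have "reldim W Z \<le> reldim ?W ?Z" .
    moreover have "reldim V W \<le> reldim ?V ?W + 1"
      by (rule step)
    ultimately have "reldim V W + reldim W Z \<le> (reldim ?V ?W + 1) + reldim ?W ?Z"
      by (intro add_mono)
    also have "\<dots> = (reldim ?V ?W + reldim ?W ?Z) + 1"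
      by (simp add: ac_simps)
    also have "\<dots> \<le> enat (card G) + 1"
      using IH by (rule add_right_mono)
    finally show ?thesis
      using card by simp
  qed
qed

lemma reldim_additive:
  assumes "cvs.subspace V" "cvs.subspace W" "cvs.subspace Z" "Z \<subseteq> W" "W \<subseteq> V"
  shows "reldim V Z = reldim V W + reldim W Z"
proof (rule antisym[OF reldim_triangle])
  show "reldim V W + reldim W Z \<le> reldim V Z"
  proof (cases "reldim V Z = \<infinity>")
    case False
    then obtain F where "finite F" "V \<subseteq> cvs.span (Z \<union> F)" "reldim V Z = enat (card F)"
      using reldim_witness by blast
    then show ?thesis
      using reldim_superadditive_aux[OF _ assms] by metis
  qed auto
qed

section \<open>Relative dimension under linear maps\<close>

lemma reldim_image_le:
  assumes "clinear f"
  shows "reldim (f ` V) (f ` W) \<le> reldim V W"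
proof (cases "reldim V W = \<infinity>")
  case False
  then obtain F where F: "finite F" "V \<subseteq> cvs.span (W \<union> F)" "reldim V W = enat (card F)"
    using reldim_witness by blast
  have "f ` V \<subseteq> cvs.span (f ` W \<union> f ` F)"
    using F(2) cvs_pair.linear_span_image[OF assms, of "W \<union> F"] by (auto simp: image_Un)
  then have "reldim (f ` V) (f ` W) \<le> enat (card (f ` F))"
    using F by (intro reldim_le_card) auto
  also have "\<dots> \<le> enat (card F)"
    using F by (simp add: card_image_le)
  finally show ?thesis
    using F by simp
qed auto

lemma subspace_null_space: "clinear f \<Longrightarrow> cvs.subspace (null_space f)"
  unfolding null_space_def by (rule cvs_pair.linear_subspace_kernel)

text \<open>The space \<open>WK = W + K\<close>, with \<open>K\<close> the kernel of
  \<open>f\<close> in \<open>V\<close>, is inserted between \<open>W\<close> and \<open>V\<close>.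
  It contains \<open>K\<close> and has the same image as \<open>W\<close>, so \<open>V / WK\<close>
  is the quotient of the images of \<open>V\<close> and \<open>W\<close>, while
  \<open>WK / W\<close> is \<open>K / (K \<inter> W)\<close>.\<close>

lemma reldim_image_null_space:
  assumes f: "clinear f" and V: "cvs.subspace V" and W: "cvs.subspace W" and WV: "W \<subseteq> V"
  shows "reldim V W = reldim (f ` V) (f ` W) + reldim (null_space f \<inter> V) (null_space f \<inter> W)"
proof -
  define K where "K = null_space f \<inter> V"
  define WK where "WK = cvs.span (W \<union> K)"
  have K: "cvs.subspace K"
    unfolding K_def using subspace_null_space[OF f] V by (rule cvs.subspace_inter)
  have WKV: "WK \<subseteq> V"
    unfolding WK_def K_def using WV V by (intro cvs.span_minimal) auto
  have f0: "f x = 0" if "x \<in> K" for x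
    using that by (auto simp: K_def null_space_def)
  have img: "f ` WK = f ` W"
  proof
    have "f ` (W \<union> K) \<subseteq> f ` W"
      using f0 cvs.subspace_0[OF W] cvs_pair.linear_0[OF f] by (metis Un_iff image_eqI image_subsetI)
    then show "f ` WK \<subseteq> f ` W"
      unfolding WK_def using cvs_pair.linear_subspace_image[OF f W] cvs_pair.linear_span_image[OF f]
      by (metis cvs.span_minimal)
    show "f ` W \<subseteq> f ` WK"
      unfolding WK_def by (auto intro: cvs.span_base)
  qed
  have 1: "reldim V WK = reldim (f ` V) (f ` W)"
  proof (rule antisym)
    show "reldim (f ` V) (f ` W) \<le> reldim V WK"
      using reldim_image_le[OF f, of V WK] img by simp
    show "reldim V WK \<le> reldim (f ` V) (f ` W)"
    proof (cases "reldim (f ` V) (f ` W) = \<infinity>")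
      case False
      obtain H where H: "finite H" "H \<subseteq> f ` V" "f ` V \<subseteq> cvs.span ((f ` V \<inter> f ` W) \<union> H)"
        "reldim (f ` V) (f ` W) = enat (card H)"
        using reldim_inside[OF cvs_pair.linear_subspace_image[OF f V]
            cvs_pair.linear_subspace_image[OF f W] False] by blast
      \<comment> \<open>As \<open>H\<close> lies inside the image of \<open>V\<close>, it lifts
        bijectively to vectors of \<open>V\<close>, which preserves the count.\<close>
      obtain G where G: "G \<subseteq> V" "inj_on f G" "H = f ` G"
        using H(2) by (meson subset_image_inj)
      have finG: "finite G" "card G = card H"
        using G H(1) by (auto simp: card_image finite_image_iff)
      have "(f ` V \<inter> f ` W) \<union> H \<subseteq> f ` (W \<union> G)"
        using G by auto
      then have fV: "f ` V \<subseteq> f ` cvs.span (W \<union> G)"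
        unfolding cvs_pair.linear_span_image[OF f, symmetric] by (rule order_trans[OF H(3) cvs.span_mono])
      have WG: "cvs.span (W \<union> G) \<subseteq> V"
        using WV G V by (intro cvs.span_minimal) auto
      have "V \<subseteq> cvs.span (WK \<union> G)"
      proof
        fix x assume x: "x \<in> V"
        then obtain y where y: "y \<in> cvs.span (W \<union> G)" "f x = f y"
          using fV by blast
        have "x - y \<in> K"
          using x y WG V unfolding K_def null_space_def
          by (auto simp: cvs_pair.linear_diff[OF f] cvs.subspace_diff)
        then have "x - y \<in> cvs.span (WK \<union> G)"
          unfolding WK_def by (auto intro: cvs.span_base)
        moreover have "W \<union> G \<subseteq> WK \<union> G"
          unfolding WK_def by (auto intro: cvs.span_base)
        then have "y \<in> cvs.span (WK \<union> G)"
          using y(1) cvs.span_mono by blast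
        ultimately show "x \<in> cvs.span (WK \<union> G)"
          using cvs.span_add by fastforce
      qed
      then show ?thesis
        using reldim_le_card[OF finG(1)] finG(2) H(4) by simp
    qed auto
  qed
  have "reldim WK W = reldim K W"
  proof (rule antisym)
    show "reldim K W \<le> reldim WK W"
      unfolding WK_def by (intro reldim_mono) (auto intro: cvs.span_base)
    show "reldim WK W \<le> reldim K W"
    proof (cases "reldim K W = \<infinity>")
      case False
      then obtain F where F: "finite F" "K \<subseteq> cvs.span (W \<union> F)" "reldim K W = enat (card F)"
        using reldim_witness by blast
      then have "WK \<subseteq> cvs.span (W \<union> F)"
        unfolding WK_def by (intro cvs.span_minimal) (auto intro: cvs.span_base)
      then show ?thesis
        using F reldim_le_card by metis
    qed auto
  qed
  also have "\<dots> = reldim K (K \<inter> W)"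
    using reldim_Int[OF K W] by simp
  also have "K \<inter> W = null_space f \<inter> W"
    unfolding K_def using WV by auto
  finally have 2: "reldim WK W = reldim K (null_space f \<inter> W)" .
  have "reldim V W = reldim V WK + reldim WK W"
    by (rule reldim_additive[OF V _ W _ WKV]) (auto simp: WK_def intro: cvs.span_base)
  then show ?thesis
    using 1 2 unfolding K_def by simp
qed

section \<open>Dimension and codimension expressed by the relative dimension\<close>

lemma edim_eq_reldim:
  assumes "cvs.subspace V"
  shows "edim V = reldim V {0}"
proof (cases "cfinite_dim V")
  case True
  then obtain G where G: "finite G" "V \<subseteq> cvs.span G"
    unfolding cfinite_dim_def by blast
  obtain B where B: "B \<subseteq> V" "cvs.independent B" "V \<subseteq> cvs.span B" "card B = cvs.dim V"
    using cvs.basis_exists by blast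
  have finB: "finite B"
    using cvs.independent_span_bound[OF G(1) B(2)] B(1) G(2) by blast
  have "reldim V {0} \<le> enat (card B)"
    using B finB by (intro reldim_le_card) simp_all
  moreover have "enat (card B) \<le> reldim V {0}"
  proof (cases "reldim V {0} = \<infinity>")
    case False
    then obtain F where F: "finite F" "V \<subseteq> cvs.span ({0} \<union> F)" "reldim V {0} = enat (card F)"
      using reldim_witness by blast
    then have "card B \<le> card F"
      using cvs.independent_span_bound[OF F(1) B(2)] B(1) by auto
    with F show ?thesis
      by simp
  qed auto
  ultimately show ?thesis
    using True B(4) unfolding edim_def by simp
next
  case False
  have "reldim V {0} = \<infinity>"
  proof (rule ccontr)
    assume "reldim V {0} \<noteq> \<infinity>"
    then obtain F where "finite F" "V \<subseteq> cvs.span ({0} \<union> F)"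
      using reldim_witness by blast
    with False show False
      unfolding cfinite_dim_def by auto
  qed
  with False show ?thesis
    unfolding edim_def by simp
qed

text \<open>The definition of \<open>ecodim\<close> wants the spanning vectors inside
  \<open>V\<close>; by \<open>reldim_inside\<close> this restriction does not raise the
  minimum.\<close>

lemma ecodim_eq_reldim:
  assumes "cvs.subspace V" "cvs.subspace W" "W \<subseteq> V"
  shows "ecodim V W = reldim V W"
proof (cases "reldim V W = \<infinity>")
  case True
  have "\<not> (\<exists>F. finite F \<and> F \<subseteq> V \<and> V \<subseteq> cvs.span (W \<union> F))"
    using True reldim_le_card[of _ V W] by auto
  with True show ?thesis
    unfolding ecodim_def by simp
next
  case False
  then obtain H where H: "finite H" "H \<subseteq> V" "V \<subseteq> cvs.span ((V \<inter> W) \<union> H)" "reldim V W = enat (card H)"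
    using reldim_inside[OF assms(1,2)] by blast
  have H3: "V \<subseteq> cvs.span (W \<union> H)"
    using H(3) assms(3) by (simp add: inf.absorb2)
  have "(LEAST n. \<exists>F. finite F \<and> card F = n \<and> F \<subseteq> V \<and> V \<subseteq> cvs.span (W \<union> F)) = card H"
  proof (rule Least_equality)
    show "\<exists>F. finite F \<and> card F = card H \<and> F \<subseteq> V \<and> V \<subseteq> cvs.span (W \<union> F)"
      using H H3 by blast
  next
    fix n assume "\<exists>F. finite F \<and> card F = n \<and> F \<subseteq> V \<and> V \<subseteq> cvs.span (W \<union> F)"
    then show "card H \<le> n"
      using reldim_le_card H(4) by (metis enat_ord_simps(1))
  qed
  then show ?thesis
    using H H3 unfolding ecodim_def by auto
qed

section \<open>Closed ranges\<close>

lemma csubspace_imp_subspace: "cvs.subspace M \<Longrightarrow> subspace M"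
  by (simp add: subspace_def cvs.subspace_def scaleR_scaleC)

lemma bounded_bilinear_scaleC:
  "bounded_bilinear (scaleC :: complex \<Rightarrow> 'a::complex_normed_vector \<Rightarrow> 'a)"
proof
  show "\<exists>K. \<forall>a (b::'a). norm (a *\<^sub>C b) \<le> norm a * norm b * K"
    by (intro exI[of _ 1]) (simp add: norm_scaleC)
qed (simp_all add: scaleC_add_left scaleC_add_right scaleR_scaleC scaleC_scaleC scaleC_complex_def mult.commute)

lemmas tendsto_scaleC [tendsto_intros] = bounded_bilinear.tendsto[OF bounded_bilinear_scaleC]

text \<open>Baire step of the open mapping theorem, for the restriction of \<open>f\<close> to
  \<open>C\<close>. The closures \<open>?A k\<close> of the images of balls cover the complete space
  \<open>?D\<close>, so one of them contains a relative ball; translating it to 0 and rescaling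
  yields approximate preimages of controlled norm.\<close>

lemma open_mapping_approx:
  fixes f :: "'a::real_normed_vector \<Rightarrow> 'b::banach"
  assumes f: "bounded_linear f" and C: "subspace C" and fC: "closed (f ` C)"
  obtains K where "K > 0"
    "\<And>y. y \<in> f ` C \<Longrightarrow> \<exists>x\<in>C. norm x \<le> K * norm y \<and> norm (y - f x) \<le> norm y / 2"
proof -
  interpret f: bounded_linear f by (rule f)
  let ?D = "f ` C"
  let ?A = "\<lambda>k::nat. closure (f ` (C \<inter> cball 0 (real k)))"
  have D: "subspace ?D"
    by (rule linear_subspace_image[OF f.linear_axioms C])
  have AD: "?A k \<subseteq> ?D" for k
    by (rule closure_minimal[OF _ fC]) auto
  have "?D \<subseteq> (\<Union>k. ?A k)"
  proof
    fix y assume "y \<in> ?D"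
    then obtain x where x: "x \<in> C" "y = f x" by blast
    obtain k :: nat where "norm x \<le> real k"
      using real_arch_simple by blast
    with x have "y \<in> ?A k"
      by (intro closure_subset[THEN subsetD]) auto
    then show "y \<in> (\<Union>k. ?A k)" by blast
  qed
  with AD have union: "(\<Union>k. ?A k) = ?D"
    by blast
  have "\<exists>k. top_of_set ?D interior_of ?A k \<noteq> {}"
  proof (rule ccontr)
    assume "\<not> ?thesis"
    moreover have "closedin (top_of_set ?D) (?A k)" for k
      by (rule closed_subset[OF AD closed_closure])
    moreover have "completely_metrizable_space (top_of_set ?D)"
      using fC by (intro completely_metrizable_space_closedin completely_metrizable_space_euclidean) auto
    ultimately have "top_of_set ?D interior_of \<Union>(range ?A) = {}"
      by (intro Baire_category_alt) auto
    moreover have "top_of_set ?D interior_of \<Union>(range ?A) = ?D"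
      unfolding union using interior_of_topspace[of "top_of_set ?D"] by simp
    ultimately show False
      using subspace_0[OF D] by auto
  qed
  then obtain k y0 where "y0 \<in> top_of_set ?D interior_of ?A k"
    by blast
  then obtain T where T: "openin (top_of_set ?D) T" "y0 \<in> T" "T \<subseteq> ?A k"
    unfolding interior_of_def by blast
  then have y0: "y0 \<in> ?D"
    using openin_imp_subset by blast
  obtain r where "r > 0" "ball y0 r \<inter> ?D \<subseteq> T"
    using T openin_contains_ball[of ?D T] by blast
  with T(3) have r: "r > 0" "ball y0 r \<inter> ?D \<subseteq> ?A k"
    by auto
  \<comment> \<open>Since \<open>y = (y0 + y) - y0\<close>, approximate preimages of both points
    near \<open>y0\<close> are subtracted, which doubles the norm bound.\<close>
  have approx: "\<exists>x\<in>C. norm x \<le> 2 * real k \<and> norm (y - f x) \<le> e" if y: "y \<in> ?D" "norm y < r" "e > 0" for y e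
  proof -
    have "y0 + y \<in> ball y0 r \<inter> ?D" "y0 \<in> ball y0 r \<inter> ?D"
      using y y0 r(1) subspace_add[OF D] by (auto simp: dist_norm)
    then have "y0 + y \<in> ?A k" "y0 \<in> ?A k"
      using r(2) by blast+
    then obtain x1 x2 where x1: "x1 \<in> C" "norm x1 \<le> k" "dist (f x1) (y0 + y) < e / 2"
      and x2: "x2 \<in> C" "norm x2 \<le> k" "dist (f x2) y0 < e / 2"
      using \<open>e > 0\<close> by (fastforce simp: closure_approachable dest!: spec[of _ "e / 2"])
    have "norm (x1 - x2) \<le> 2 * real k"
      using x1(2) x2(2) norm_triangle_ineq4[of x1 x2] by simp
    moreover have "y - f (x1 - x2) = (f x2 - y0) - (f x1 - (y0 + y))"
      by (simp add: f.diff)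
    then have "norm (y - f (x1 - x2)) \<le> norm (f x2 - y0) + norm (f x1 - (y0 + y))"
      by (metis norm_triangle_ineq4)
    then have "norm (y - f (x1 - x2)) \<le> e"
      using x1(3) x2(3) by (simp add: dist_norm)
    ultimately show ?thesis
      using subspace_diff[OF C x1(1) x2(1)] by blast
  qed
  \<comment> \<open>A nonzero \<open>y\<close> is rescaled to norm \<open>r / 2\<close>, where
    preimages of norm at most \<open>2 * real k\<close> are available; the summand 1 keeps
    \<open>K\<close> positive when \<open>k = 0\<close>.\<close>
  define K where "K = 2 * (2 * real k + 1) / r"
  show thesis
  proof
    show "K > 0"
      using r by (simp add: K_def)
    fix y assume y: "y \<in> ?D"
    show "\<exists>x\<in>C. norm x \<le> K * norm y \<and> norm (y - f x) \<le> norm y / 2"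
    proof (cases "y = 0")
      case True
      then show ?thesis
        using subspace_0[OF C] by (intro bexI[of _ 0]) (auto simp: f.zero)
    next
      case False
      define c where "c = r / (2 * norm y)"
      have c: "c > 0" "c * norm y = r / 2"
        using False r by (simp_all add: c_def)
      have "norm (c *\<^sub>R y) < r"
        using c r by simp
      then obtain x where x: "x \<in> C" "norm x \<le> 2 * real k" "norm (c *\<^sub>R y - f x) \<le> c * norm y / 2"
        using approx[of "c *\<^sub>R y" "c * norm y / 2"] subspace_scale[OF D y] c False by fastforce
      have "y - f (x /\<^sub>R c) = (c *\<^sub>R y - f x) /\<^sub>R c"
        using c by (simp add: f.scaleR scaleR_right_diff_distrib)
      then have "norm (y - f (x /\<^sub>R c)) = norm (c *\<^sub>R y - f x) / c"
        using c(1) by (simp add: divide_inverse mult.commute)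
      also have "\<dots> \<le> norm y / 2"
        using x(3) c(1) by (simp add: pos_divide_le_eq mult.commute)
      finally have "norm (y - f (x /\<^sub>R c)) \<le> norm y / 2" .
      moreover have "norm (x /\<^sub>R c) \<le> K * norm y"
      proof -
        have "norm (x /\<^sub>R c) \<le> (2 * real k + 1) / c"
          using x(2) c by (simp add: field_simps)
        also have "\<dots> = K * norm y"
          using r False by (simp add: K_def c_def field_simps)
        finally show ?thesis .
      qed
      ultimately show ?thesis
        using subspace_scale[OF C x(1)] by blast
    qed
  qed
qed

text \<open>The approximate solution is applied again and again to the residual, which at least
  halves each time. The corrections sum to an exact preimage in the closed space \<open>C\<close>,
  and the geometric series accounts for the factor 2 in \<open>2 * K\<close>.\<close>

lemma open_mapping_on:
  fixes f :: "'a::banach \<Rightarrow> 'b::banach"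
  assumes f: "bounded_linear f" and C: "subspace C" "closed C" and fC: "closed (f ` C)"
  obtains K where "\<And>y. y \<in> f ` C \<Longrightarrow> \<exists>x\<in>C. f x = y \<and> norm x \<le> K * norm y"
proof -
  interpret f: bounded_linear f by (rule f)
  obtain K where K: "K > 0"
    "\<And>y. y \<in> f ` C \<Longrightarrow> \<exists>x\<in>C. norm x \<le> K * norm y \<and> norm (y - f x) \<le> norm y / 2"
    using open_mapping_approx[OF f C(1) fC] by blast
  then obtain g where g: "\<And>y. y \<in> f ` C \<Longrightarrow> g y \<in> C"
    "\<And>y. y \<in> f ` C \<Longrightarrow> norm (g y) \<le> K * norm y"
    "\<And>y. y \<in> f ` C \<Longrightarrow> norm (y - f (g y)) \<le> norm y / 2"
    by metis
  have D: "subspace (f ` C)"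
    by (rule linear_subspace_image[OF f.linear_axioms C(1)])
  have "\<exists>x\<in>C. f x = y \<and> norm x \<le> 2 * K * norm y" if y: "y \<in> f ` C" for y
  proof -
    \<comment> \<open>\<open>z n\<close> is the residual left after \<open>n\<close> corrections,
      and \<open>g (z n)\<close> is the next correction.\<close>
    define z where "z n = ((\<lambda>y. y - f (g y)) ^^ n) y" for n
    have z0: "z 0 = y" and zSuc: "z (Suc n) = z n - f (g (z n))" for n
      by (simp_all add: z_def)
    have zD: "z n \<in> f ` C" for n
      by (induction n) (use y subspace_diff[OF D] g(1) in \<open>auto simp: z0 zSuc\<close>)
    have znorm: "norm (z n) \<le> norm y * (1/2) ^ n" for n
    proof (induction n)
      case (Suc n)
      then show ?case
        using g(3)[OF zD[of n]] by (simp add: zSuc)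
    qed (simp add: z0)
    have znull: "z \<longlonglongrightarrow> 0"
    proof (rule Lim_null_comparison)
      show "\<forall>\<^sub>F n in sequentially. norm (z n) \<le> norm y * (1/2) ^ n"
        using znorm by simp
      show "(\<lambda>n. norm y * (1/2) ^ n) \<longlonglongrightarrow> 0"
        by (intro tendsto_mult_right_zero LIMSEQ_power_zero) simp
    qed
    have gnorm: "norm (g (z n)) \<le> K * norm y * (1/2) ^ n" for n
    proof -
      have "norm (g (z n)) \<le> K * norm (z n)"
        by (rule g(2)[OF zD])
      also have "\<dots> \<le> K * (norm y * (1/2) ^ n)"
        using K(1) znorm by (intro mult_left_mono) auto
      finally show ?thesis
        by (simp add: mult.assoc)
    qed
    have geo: "summable (\<lambda>n. K * norm y * (1/2) ^ n)"
      by (intro summable_mult summable_geometric) simp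
    have sumn: "summable (\<lambda>n. norm (g (z n)))"
      by (rule summable_comparison_test'[OF geo]) (use gnorm in simp)
    have sum: "summable (\<lambda>n. g (z n))"
      by (rule summable_norm_cancel[OF sumn])
    define x where "x = (\<Sum>n. g (z n))"
    have "norm x \<le> (\<Sum>n. norm (g (z n)))"
      unfolding x_def by (rule summable_norm[OF sumn])
    also have "\<dots> \<le> (\<Sum>n. K * norm y * (1/2) ^ n)"
      by (rule suminf_le[OF gnorm sumn geo])
    also have "\<dots> = K * norm y * 2"
      by (subst suminf_mult) (simp_all add: suminf_geometric)
    finally have "norm x \<le> 2 * K * norm y"
      by simp
    moreover have "x \<in> C"
    proof (rule closed_sequentially[OF C(2)])
      show "(\<Sum>i<n. g (z i)) \<in> C" for n
        by (intro subspace_sum[OF C(1)] g(1) zD)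
      show "(\<lambda>n. \<Sum>i<n. g (z i)) \<longlonglongrightarrow> x"
        unfolding x_def by (rule summable_LIMSEQ[OF sum])
    qed
    moreover have "f x = y"
    proof -
      have "(\<lambda>n. f (g (z n))) sums f x"
        unfolding x_def by (rule f.sums[OF summable_sums[OF sum]])
      moreover have "(\<lambda>n. z n - z (Suc n)) sums (z 0 - 0)"
        by (rule telescope_sums'[OF znull])
      then have "(\<lambda>n. f (g (z n))) sums y"
        by (simp add: zSuc z0)
      ultimately show ?thesis
        by (rule sums_unique2)
    qed
    ultimately show ?thesis
      by blast
  qed
  then show thesis
    by (rule that)
qed

section \<open>Finite-dimensional extensions of closed subspaces\<close>

lemma closed_csubspace_coeff_bound:
  fixes M :: "'a::complex_normed_vector set"
  assumes M: "closed M" "cvs.subspace M" and e: "e \<notin> M"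
  obtains d where "d > 0" "\<And>w c. w \<in> M \<Longrightarrow> d * cmod c \<le> norm (w + c *\<^sub>C e)"
proof -
  have "open (- M)" "e \<in> - M"
    using M e by auto
  then obtain d where d: "d > 0" "ball e d \<subseteq> - M"
    by (metis open_contains_ball)
  have "d * cmod c \<le> norm (w + c *\<^sub>C e)" if w: "w \<in> M" for w c
  proof (cases "c = 0")
    case False
    \<comment> \<open>Dividing by \<open>c\<close> reduces to the coefficient 1: the ball of radius
      \<open>d\<close> around \<open>e\<close> misses \<open>M\<close>, hence the point
      \<open>- w / c\<close>.\<close>
    have "(- inverse c) *\<^sub>C w \<in> M"
      by (rule cvs.subspace_scale[OF M(2) w])
    then have "(- inverse c) *\<^sub>C w \<notin> ball e d"
      using d(2) by blast
    then have "d \<le> norm (e + inverse c *\<^sub>C w)"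
      by (simp add: dist_norm)
    then have "cmod c * d \<le> cmod c * norm (e + inverse c *\<^sub>C w)"
      by (intro mult_left_mono) auto
    also have "\<dots> = norm (c *\<^sub>C (e + inverse c *\<^sub>C w))"
      by (simp add: norm_scaleC)
    also have "c *\<^sub>C (e + inverse c *\<^sub>C w) = w + c *\<^sub>C e"
      using False by (simp add: scaleC_add_right scaleC_scaleC)
    finally show ?thesis
      by (simp add: mult.commute)
  qed auto
  with d(1) that show thesis
    by blast
qed

text \<open>Modulo a closed subspace the coefficient of \<open>e\<close> is controlled by the norm,
  so Bolzano-Weierstrass applies to the scalars. This is the inductive step for statements about
  finite-dimensional extensions.\<close>

lemma bounded_coeff_subseq:
  fixes M :: "'a::complex_normed_vector set"
  assumes M: "closed M" "cvs.subspace M" and e: "e \<notin> M"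
    and w: "\<And>n. w n \<in> M" and bdd: "bounded (range (\<lambda>n. w n + c n *\<^sub>C e))"
  obtains r l where "strict_mono (r :: nat \<Rightarrow> nat)" "(\<lambda>n. c (r n)) \<longlonglongrightarrow> l"
proof -
  obtain d where d: "d > 0" "\<And>w c. w \<in> M \<Longrightarrow> d * cmod c \<le> norm (w + c *\<^sub>C e)"
    using closed_csubspace_coeff_bound[OF M e] by blast
  obtain B where B: "\<And>n. norm (w n + c n *\<^sub>C e) \<le> B"
    using bdd by (auto simp: bounded_iff)
  have "cmod (c n) \<le> B / d" for n
    using order_trans[OF d(2)[OF w] B] d(1) by (simp add: field_simps)
  then have "bounded (range c)"
    by (auto simp: bounded_iff)
  then show thesis
    using bounded_imp_convergent_subsequence[of c] that by (auto simp: o_def)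
qed

lemma closed_span_insert:
  fixes M :: "'a::complex_normed_vector set"
  assumes M: "closed M" "cvs.subspace M"
  shows "closed (cvs.span (insert e M))"
proof (cases "e \<in> M")
  case True
  then show ?thesis
    using M by (metis insert_absorb cvs.span_eq_iff)
next
  case False
  show ?thesis
    unfolding closed_sequential_limits
  proof (intro allI impI, elim conjE)
    fix x l assume x: "\<forall>n. x n \<in> cvs.span (insert e M)" and lim: "x \<longlonglongrightarrow> l"
    then obtain c where c: "\<And>n. x n - c n *\<^sub>C e \<in> M"
      unfolding span_insert_subspace[OF M(2)] by metis
    have "bounded (range x)"
      using lim by (rule convergent_imp_bounded)
    then obtain r k where r: "strict_mono (r :: nat \<Rightarrow> nat)" "(\<lambda>n. c (r n)) \<longlonglongrightarrow> k"
      using bounded_coeff_subseq[OF M False, of "\<lambda>n. x n - c n *\<^sub>C e" c] c by auto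
    have "(\<lambda>n. x (r n) - c (r n) *\<^sub>C e) \<longlonglongrightarrow> l - k *\<^sub>C e"
      using LIMSEQ_subseq_LIMSEQ[OF lim r(1)] r(2)
      by (intro tendsto_intros) (auto simp: o_def)
    then have "l - k *\<^sub>C e \<in> M"
      by (rule closed_sequentially[OF M(1) c])
    then show "l \<in> cvs.span (insert e M)"
      using span_insert_subspace[OF M(2)] by blast
  qed
qed

lemma closed_span_Un_finite:
  fixes M :: "'a::complex_normed_vector set"
  assumes "finite H" and M: "closed M" "cvs.subspace M"
  shows "closed (cvs.span (M \<union> H))"
  using assms(1)
proof (induction H rule: finite_induct)
  case empty
  then show ?case
    using M by (metis sup_bot_right cvs.span_eq_iff)
next
  case (insert e H)
  have "cvs.span (insert e (cvs.span (M \<union> H))) = cvs.span (M \<union> insert e H)"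
    by (simp add: cvs.span_insert cvs.span_span)
  then show ?case
    using closed_span_insert[OF insert.IH cvs.subspace_span, of e] by simp
qed

lemma closed_cspan_finite: "finite H \<Longrightarrow> closed (cvs.span (H :: 'a::complex_normed_vector set))"
  using closed_span_Un_finite[of H "{0}"] by simp

text \<open>Compactness in finite dimensions, splitting off one coefficient at a time. Redundant
  vectors are dropped first, because the coefficient of \<open>e\<close> is controlled only if
  \<open>e\<close> lies outside the closed span of the others.\<close>

lemma bounded_cspan_finite_subseq:
  fixes x :: "nat \<Rightarrow> 'a::complex_normed_vector"
  assumes "finite H" and "\<And>n. x n \<in> cvs.span H" and "bounded (range x)"
  shows "\<exists>l r. strict_mono (r :: nat \<Rightarrow> nat) \<and> (\<lambda>n. x (r n)) \<longlonglongrightarrow> l"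
  using assms
proof (induction H arbitrary: x rule: finite_induct)
  case empty
  then show ?case
    by (intro exI[of _ 0] exI[of _ id]) (use strict_mono_id in \<open>auto simp: id_def\<close>)
next
  case (insert e H)
  show ?case
  proof (cases "e \<in> cvs.span H")
    case True
    then show ?thesis
      using insert by (metis cvs.span_redundant)
  next
    case False
    have H: "closed (cvs.span H)" "cvs.subspace (cvs.span H)"
      using closed_cspan_finite[OF insert.hyps(1)] by auto
    obtain c where c: "\<And>n. x n - c n *\<^sub>C e \<in> cvs.span H"
      using insert.prems(1) unfolding cvs.span_breakdown_eq by metis
    obtain r k where r: "strict_mono (r :: nat \<Rightarrow> nat)" "(\<lambda>n. c (r n)) \<longlonglongrightarrow> k"
      using bounded_coeff_subseq[OF H False, of "\<lambda>n. x n - c n *\<^sub>C e" c] c insert.prems(2) by auto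
    define w where "w n = x (r n) - c (r n) *\<^sub>C e" for n
    have ce: "(\<lambda>n. c (r n) *\<^sub>C e) \<longlonglongrightarrow> k *\<^sub>C e"
      by (intro tendsto_intros r)
    have "bounded (range (\<lambda>n. x (r n)))"
      by (rule bounded_subset[OF insert.prems(2)]) auto
    moreover have "bounded (range (\<lambda>n. c (r n) *\<^sub>C e))"
      using ce by (rule convergent_imp_bounded)
    ultimately have "bounded (range w)"
      unfolding w_def by (rule bounded_minus_comp)
    then obtain l s where s: "strict_mono (s :: nat \<Rightarrow> nat)" "(\<lambda>n. w (s n)) \<longlonglongrightarrow> l"
      using insert.IH[of w] c unfolding w_def by blast
    have "(\<lambda>n. w (s n) + c (r (s n)) *\<^sub>C e) \<longlonglongrightarrow> l + k *\<^sub>C e"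
      using LIMSEQ_subseq_LIMSEQ[OF ce s(1)] s(2) by (intro tendsto_add) (auto simp: o_def)
    then have "(\<lambda>n. x ((r \<circ> s) n)) \<longlonglongrightarrow> l + k *\<^sub>C e"
      by (simp add: w_def)
    then show ?thesis
      using strict_mono_o[OF r(1) s(1)] by blast
  qed
qed

text \<open>A vector of \<open>H\<close> is kept only if it is not yet in the span of
  \<open>A\<close> and the vectors kept before, so the sum stays direct.\<close>

lemma finite_complement:
  assumes "finite H" and A: "cvs.subspace A"
  shows "\<exists>G. finite G \<and> cvs.span (A \<union> G) = cvs.span (A \<union> H) \<and> A \<inter> cvs.span G = {0}"
  using assms(1)
proof (induction H rule: finite_induct)
  case empty
  show ?case
    by (rule exI[of _ "{}"]) (use cvs.subspace_0[OF A] in auto)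
next
  case (insert e H)
  obtain G where G: "finite G" "cvs.span (A \<union> G) = cvs.span (A \<union> H)" "A \<inter> cvs.span G = {0}"
    using insert.IH by (elim exE conjE)
  have span_e: "cvs.span (A \<union> insert e G) = cvs.span (A \<union> insert e H)"
    by (simp add: cvs.span_insert G(2))
  show ?case
  proof (cases "e \<in> cvs.span (A \<union> G)")
    case True
    then have "cvs.span (A \<union> G) = cvs.span (A \<union> insert e H)"
      using span_e by (simp add: cvs.span_redundant)
    then show ?thesis
      using G by blast
  next
    case False
    have "a = 0" if a: "a \<in> A" "a \<in> cvs.span (insert e G)" for a
    proof -
      obtain c where c: "a - c *\<^sub>C e \<in> cvs.span G"
        using a(2) unfolding cvs.span_breakdown_eq by blast
      have "c = 0"
      proof (rule ccontr)
        assume "c \<noteq> 0"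
        have "a - (a - c *\<^sub>C e) \<in> cvs.span (A \<union> G)"
          by (rule cvs.span_diff) (use a(1) c cvs.span_mono[of G "A \<union> G"] in \<open>auto intro: cvs.span_base\<close>)
        then have "inverse c *\<^sub>C (c *\<^sub>C e) \<in> cvs.span (A \<union> G)"
          by (intro cvs.span_scale[where x = "c *\<^sub>C e"]) simp
        with False \<open>c \<noteq> 0\<close> show False
          by (simp add: scaleC_scaleC)
      qed
      then show "a = 0"
        using a(1) c G(3) by auto
    qed
    then have "A \<inter> cvs.span (insert e G) = {0}"
      using cvs.subspace_0[OF A] cvs.span_zero by blast
    then show ?thesis
      using G(1) span_e by (intro exI[of _ "insert e G"]) simp
  qed
qed

text \<open>Make the sum direct by passing from \<open>H\<close> to \<open>G\<close>. Then
  \<open>(x, h)\<close> is sent to \<open>f x + h\<close> onto a closed space, and the open mapping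
  bound controls the \<open>G\<close>-component. If points of the range of \<open>f\<close> converge
  to \<open>f x + h\<close>, their differences from the limit have \<open>G\<close>-component
  \<open>- h\<close> and norm tending to 0, so \<open>h = 0\<close>.\<close>

lemma closed_range_of_closed_span:
  fixes f :: "'a::complex_banach \<Rightarrow> 'a"
  assumes f: "bounded_clinear_op f" and "finite H" and cl: "closed (cvs.span (range f \<union> H))"
  shows "closed (range f)"
proof -
  have lin: "clinear f" and bl: "bounded_linear f"
    using f by (auto simp: bounded_clinear_op_def)
  interpret f: bounded_linear f by (rule bl)
  have A: "cvs.subspace (range f)"
    by (rule cvs_pair.linear_subspace_image[OF lin]) simp
  obtain G where G: "finite G" "cvs.span (range f \<union> G) = cvs.span (range f \<union> H)"
    "range f \<inter> cvs.span G = {0}"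
    using finite_complement[OF assms(2) A] by blast
  define g :: "'a \<times> 'a \<Rightarrow> 'a" where "g = (\<lambda>(x, h). f x + h)"
  define C where "C = (UNIV :: 'a set) \<times> cvs.span G"
  have g: "bounded_linear g"
    unfolding g_def case_prod_unfold
    by (intro bounded_linear_add bounded_linear_compose[OF bl] bounded_linear_fst bounded_linear_snd)
  have C: "subspace C" "closed C"
    unfolding C_def using csubspace_imp_subspace[of "cvs.span G"] closed_cspan_finite[OF G(1)]
    by (auto intro: subspace_Times closed_Times)
  have "g ` C = cvs.span (range f \<union> G)"
    unfolding cvs.span_Un cvs.span_eq_iff[THEN iffD2, OF A] g_def C_def by force
  then have "closed (g ` C)"
    using cl G(2) by simp
  then obtain K where K: "\<And>y. y \<in> g ` C \<Longrightarrow> \<exists>x\<in>C. g x = y \<and> norm x \<le> K * norm y"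
    using open_mapping_on[OF g C] by blast
  show ?thesis
    unfolding closed_sequential_limits
  proof (intro allI impI, elim conjE)
    fix y l assume y: "\<forall>n. y n \<in> range f" and lim: "y \<longlonglongrightarrow> l"
    have "y n \<in> cvs.span (range f \<union> G)" for n
      using y by (auto intro: cvs.span_base)
    then have "l \<in> cvs.span (range f \<union> G)"
      using closed_sequentially[OF _ _ lim] cl G(2) by metis
    then have "l \<in> g ` C"
      using \<open>g ` C = _\<close> by simp
    then obtain x h where l: "l = f x + h" "h \<in> cvs.span G"
      by (auto simp: g_def C_def)
    have "norm h \<le> K * norm (y n - l)" for n
    proof -
      obtain u where u: "y n = f u"
        using y by blast
      have "y n - l = g (u - x, - h)"
        by (simp add: g_def u l f.diff)
      moreover have "(u - x, - h) \<in> C"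
        using l by (simp add: C_def cvs.span_neg)
      ultimately obtain x' h' where x': "(x', h') \<in> C" "f x' + h' = y n - l"
        "norm (x', h') \<le> K * norm (y n - l)"
        using K[of "y n - l"] by (force simp: g_def)
      \<comment> \<open>\<open>y n - l\<close> is now written in two ways; comparing them in the
        direct sum forces \<open>h' = - h\<close>.\<close>
      have "f (u - x - x') = h' + h"
        using x'(2) by (simp add: u l f.diff f.add algebra_simps)
      moreover have "h' + h \<in> cvs.span G"
        using x'(1) l(2) by (simp add: C_def cvs.span_add)
      ultimately have "h' + h \<in> range f \<inter> cvs.span G"
        by (metis IntI rangeI)
      then have "h' = - h"
        using G(3) by (simp add: eq_neg_iff_add_eq_0)
      then show ?thesis
        using x'(3) norm_snd_le[of h' x'] by simp
    qed
    moreover have "(\<lambda>n. K * norm (y n - l)) \<longlonglongrightarrow> 0"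
      using lim by (intro tendsto_mult_right_zero tendsto_norm_zero) (simp add: LIM_zero_iff)
    ultimately have "norm h \<le> 0"
      by (intro LIMSEQ_le_const[of _ 0]) auto
    then show "l \<in> range f"
      using l by simp
  qed
qed

text \<open>A sequential form of being upper semi-Fredholm on a closed subspace. Unlike closedness
  of the range, it passes directly to compositions, to the factor applied first in a composition,
  and to finite rank perturbations.\<close>

definition proper_on :: "'a::metric_space set \<Rightarrow> ('a \<Rightarrow> 'b::topological_space) \<Rightarrow> bool" where
  "proper_on M f \<longleftrightarrow> (\<forall>x y. range x \<subseteq> M \<longrightarrow> bounded (range x) \<longrightarrow> (\<lambda>n. f (x n)) \<longlonglongrightarrow> y \<longrightarrow>
     (\<exists>l r. strict_mono (r :: nat \<Rightarrow> nat) \<and> (\<lambda>n. x (r n)) \<longlonglongrightarrow> l))"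

lemma proper_onD:
  assumes "proper_on M f" "\<And>n. x n \<in> M" "bounded (range x)" "(\<lambda>n. f (x n)) \<longlonglongrightarrow> y"
  obtains l r where "strict_mono (r :: nat \<Rightarrow> nat)" "(\<lambda>n. x (r n)) \<longlonglongrightarrow> l"
  using assms unfolding proper_on_def by (metis image_subsetI)

text \<open>The open mapping bound gives \<open>u n\<close> in \<open>M\<close> with the same image
  as \<open>x n - x0\<close> and tending to 0. The rest \<open>x n - x0 - u n\<close> is a bounded
  sequence in the finite-dimensional kernel.\<close>

lemma upper_sf_imp_proper_on:
  fixes f :: "'a::complex_banach \<Rightarrow> 'a"
  assumes f: "bounded_clinear_op f" and M: "cvs.subspace M" "closed M"
    and cl: "closed (f ` M)" and fin: "finite H" "null_space f \<inter> M \<subseteq> cvs.span H"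
  shows "proper_on M f"
  unfolding proper_on_def
proof (intro allI impI)
  fix x y assume x: "range x \<subseteq> M" "bounded (range x)" "(\<lambda>n. f (x n)) \<longlonglongrightarrow> y"
  interpret f: bounded_linear f
    using f by (simp add: bounded_clinear_op_def)
  obtain K where K: "\<And>y. y \<in> f ` M \<Longrightarrow> \<exists>x\<in>M. f x = y \<and> norm x \<le> K * norm y"
    using open_mapping_on[OF f.bounded_linear_axioms csubspace_imp_subspace[OF M(1)] M(2) cl] by blast
  have "y \<in> f ` M"
    using closed_sequentially[OF cl _ x(3)] x(1) by blast
  then obtain x0 where x0: "x0 \<in> M" "y = f x0"
    by blast
  have "\<exists>u\<in>M. f u = f (x n - x0) \<and> norm u \<le> K * norm (f (x n - x0))" for n
    using K x(1) x0(1) cvs.subspace_diff[OF M(1)] by blast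
  then obtain u where u: "\<And>n. u n \<in> M" "\<And>n. f (u n) = f (x n - x0)"
    "\<And>n. norm (u n) \<le> K * norm (f (x n - x0))"
    by metis
  have "(\<lambda>n. f (x n - x0)) \<longlonglongrightarrow> 0"
    using x(3) unfolding f.diff x0(2) by (simp add: LIM_zero_iff)
  then have "(\<lambda>n. K * norm (f (x n - x0))) \<longlonglongrightarrow> 0"
    by (intro tendsto_mult_right_zero tendsto_norm_zero)
  then have u0: "u \<longlonglongrightarrow> 0"
    by (rule Lim_null_comparison[rotated]) (use u(3) in simp)
  define w where "w n = x n - x0 - u n" for n
  have "f (w n) = 0" for n
    by (simp add: w_def f.diff u(2))
  moreover have "w n \<in> M" for n
    unfolding w_def using x(1) x0(1) u(1) cvs.subspace_diff[OF M(1)] by blast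
  ultimately have "w n \<in> cvs.span H" for n
    using fin(2) by (auto simp: null_space_def)
  moreover have "bounded (range w)"
    unfolding w_def using convergent_imp_bounded[OF u0] x(2)
    by (intro bounded_minus_comp) auto
  ultimately obtain l r where r: "strict_mono (r :: nat \<Rightarrow> nat)" "(\<lambda>n. w (r n)) \<longlonglongrightarrow> l"
    using bounded_cspan_finite_subseq[OF fin(1)] by blast
  have "(\<lambda>n. w (r n) + x0 + u (r n)) \<longlonglongrightarrow> l + x0 + 0"
    using r(2) LIMSEQ_subseq_LIMSEQ[OF u0 r(1)] by (intro tendsto_intros) (auto simp: o_def)
  then have "(\<lambda>n. x (r n)) \<longlonglongrightarrow> l + x0"
    by (simp add: w_def)
  with r(1) show "\<exists>l r. strict_mono (r :: nat \<Rightarrow> nat) \<and> (\<lambda>n. x (r n)) \<longlonglongrightarrow> l"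
    by blast
qed

text \<open>Preimages \<open>x n\<close> of almost minimal norm take the place of a complement of
  the kernel. If they were unbounded, their normalisations would accumulate at a kernel vector
  \<open>l\<close>, and subtracting a multiple of \<open>l\<close> would shorten some
  \<open>x n\<close> too much. So they are bounded, and properness applies to them.\<close>

lemma proper_on_imp_closed_image:
  fixes f :: "'a::real_normed_vector \<Rightarrow> 'b::real_normed_vector"
  assumes f: "bounded_linear f" and p: "proper_on M f" and M: "subspace M" "closed M"
  shows "closed (f ` M)"
  unfolding closed_sequential_limits
proof (intro allI impI, elim conjE)
  interpret f: bounded_linear f by (rule f)
  fix y l assume y: "\<forall>n. y n \<in> f ` M" and lim: "y \<longlonglongrightarrow> l"
  have "\<exists>x\<in>M. f x = y n \<and> (\<forall>x'\<in>M. f x' = y n \<longrightarrow> norm x \<le> norm x' + 1)" for n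
  proof -
    let ?N = "norm ` {x \<in> M. f x = y n}"
    have ne: "?N \<noteq> {}"
      using y[rule_format, of n] by force
    have bdd: "bdd_below ?N"
      by (rule bdd_belowI[of _ 0]) auto
    obtain a where "a \<in> ?N" "a < Inf ?N + 1"
      using cInf_lessD[OF ne, of "Inf ?N + 1"] by auto
    then show ?thesis
      using cInf_lower[OF _ bdd] by fastforce
  qed
  then obtain x where x: "\<And>n. x n \<in> M" "\<And>n. f (x n) = y n"
    and xmin: "\<And>n x'. x' \<in> M \<Longrightarrow> f x' = y n \<Longrightarrow> norm (x n) \<le> norm x' + 1"
    by metis
  have bdd: "bounded (range x)"
  proof (rule ccontr)
    assume "\<not> bounded (range x)"
    then have "\<exists>k. norm (x k) > real n + 1" for n
      by (auto simp: bounded_iff not_le)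
    then obtain s where s: "\<And>n. norm (x (s n)) > real n + 1"
      by metis
    have pos: "norm (x (s n)) > 0" for n
      using s[of n] by linarith
    define z where "z n = x (s n) /\<^sub>R norm (x (s n))" for n
    have z: "z n \<in> M" "norm (z n) = 1" for n
      using subspace_scale[OF M(1) x(1)] pos[of n] by (auto simp: z_def)
    have ybdd: "bounded (range y)"
      using lim by (rule convergent_imp_bounded)
    then obtain B where B: "\<And>n. norm (y n) \<le> B"
      by (auto simp: bounded_iff)
    have inv: "norm (inverse (norm (x (s n)))) \<le> inverse (real (Suc n))" for n
      using s[of n] pos[of n] by (simp add: le_imp_inverse_le)
    have inv0: "(\<lambda>n. inverse (norm (x (s n)))) \<longlonglongrightarrow> 0"
      by (rule Lim_null_comparison[OF _ LIMSEQ_inverse_real_of_nat]) (use inv in simp)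
    have "(\<lambda>n. B * inverse (norm (x (s n)))) \<longlonglongrightarrow> 0"
      by (rule tendsto_mult_right_zero[OF inv0])
    moreover have "norm (f (z n)) \<le> B * inverse (norm (x (s n)))" for n
      using B[of "s n"] pos[of n] by (simp add: z_def f.scaleR x(2) field_simps)
    ultimately have fz0: "(\<lambda>n. f (z n)) \<longlonglongrightarrow> 0"
      by (intro Lim_null_comparison[of "\<lambda>n. f (z n)"]) auto
    have "bounded (range z)"
      using z(2) by (auto simp: bounded_iff)
    then obtain l r where r: "strict_mono (r :: nat \<Rightarrow> nat)" and zl: "(\<lambda>n. z (r n)) \<longlonglongrightarrow> l"
      using proper_onD[OF p z(1) _ fz0] by metis
    have lM: "l \<in> M"
      using closed_sequentially[OF M(2) z(1) zl] .
    have "(\<lambda>n. f (z (r n))) \<longlonglongrightarrow> f l"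
      by (rule f.tendsto[OF zl])
    then have fl: "f l = 0"
      using LIMSEQ_subseq_LIMSEQ[OF fz0 r] LIMSEQ_unique by (auto simp: o_def)
    \<comment> \<open>The competitor in the near-minimality of \<open>x (s n)\<close> is
      \<open>x (s n)\<close> minus \<open>norm (x (s n))\<close> times \<open>l\<close>, which has
      the same image because \<open>f l = 0\<close>.\<close>
    have "1 \<le> norm (z n - l) + inverse (norm (x (s n)))" for n
    proof -
      let ?a = "norm (x (s n))"
      have "norm (x (s n)) \<le> norm (x (s n) - ?a *\<^sub>R l) + 1"
        by (rule xmin) (use x lM fl subspace_diff[OF M(1)] subspace_scale[OF M(1)] in \<open>auto simp: f.diff f.scaleR\<close>)
      also have "x (s n) - ?a *\<^sub>R l = ?a *\<^sub>R (z n - l)"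
        using pos[of n] by (simp add: z_def scaleR_right_diff_distrib)
      also have "norm \<dots> = ?a * norm (z n - l)"
        by simp
      finally show ?thesis
        using pos[of n] by (simp add: field_simps)
    qed
    moreover have "(\<lambda>n. norm (z (r n) - l) + inverse (norm (x (s (r n))))) \<longlonglongrightarrow> 0 + 0"
      using zl LIMSEQ_subseq_LIMSEQ[OF inv0 r]
      by (intro tendsto_add tendsto_norm_zero) (auto simp: LIM_zero_iff o_def)
    ultimately have "(1::real) \<le> 0"
      by (intro LIMSEQ_le_const[of _ 0]) auto
    then show False
      by simp
  qed
  have "(\<lambda>n. f (x n)) \<longlonglongrightarrow> l"
    using lim x(2) by simp
  then obtain k r where r: "strict_mono (r :: nat \<Rightarrow> nat)" and xk: "(\<lambda>n. x (r n)) \<longlonglongrightarrow> k"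
    using proper_onD[OF p x(1) bdd] by metis
  have "k \<in> M"
    using closed_sequentially[OF M(2) x(1) xk] .
  moreover have "f k = l"
    using f.tendsto[OF xk] LIMSEQ_subseq_LIMSEQ[OF lim r] LIMSEQ_unique by (auto simp: x(2) o_def)
  ultimately show "l \<in> f ` M"
    by blast
qed

text \<open>Used to pass from a product \<open>V U\<close> that is known to be proper to its factor
  \<open>U\<close>.\<close>

lemma proper_on_of_comp:
  assumes v: "bounded_linear v" and p: "proper_on M (\<lambda>x. v (f x))"
  shows "proper_on M f"
  unfolding proper_on_def
proof (intro allI impI)
  fix x y assume x: "range x \<subseteq> M" "bounded (range x)" "(\<lambda>n. f (x n)) \<longlonglongrightarrow> y"
  then show "\<exists>l r. strict_mono (r :: nat \<Rightarrow> nat) \<and> (\<lambda>n. x (r n)) \<longlonglongrightarrow> l"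
    using p bounded_linear.tendsto[OF v x(3)] unfolding proper_on_def by blast
qed

lemma proper_on_comp:
  assumes f: "bounded_linear f" and pf: "proper_on M f" and fM: "f ` M \<subseteq> M'" and pg: "proper_on M' g"
  shows "proper_on M (\<lambda>x. g (f x))"
  unfolding proper_on_def
proof (intro allI impI)
  fix x y assume x: "range x \<subseteq> M" "bounded (range x)" "(\<lambda>n. g (f (x n))) \<longlonglongrightarrow> y"
  have "bounded (range (\<lambda>n. f (x n)))"
    using bounded_linear_image[OF x(2) f] by (simp add: image_image)
  moreover have "f (x n) \<in> M'" for n
    using x(1) fM by blast
  ultimately obtain l r where r: "strict_mono (r :: nat \<Rightarrow> nat)" and l: "(\<lambda>n. f (x (r n))) \<longlonglongrightarrow> l"
    using proper_onD[OF pg _ _ x(3)] by metis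
  have "bounded (range (\<lambda>n. x (r n)))"
    by (rule bounded_subset[OF x(2)]) auto
  moreover have "x (r n) \<in> M" for n
    using x(1) by blast
  ultimately obtain k s where "strict_mono (s :: nat \<Rightarrow> nat)" "(\<lambda>n. x (r (s n))) \<longlonglongrightarrow> k"
    using proper_onD[OF pf _ _ l] by metis
  then show "\<exists>l r. strict_mono (r :: nat \<Rightarrow> nat) \<and> (\<lambda>n. x (r n)) \<longlonglongrightarrow> l"
    using strict_mono_o[OF r] by (intro exI[of _ k] exI[of _ "r \<circ> s"]) simp
qed

lemma proper_on_funpow:
  fixes f :: "'a::real_normed_vector \<Rightarrow> 'a"
  assumes f: "bounded_linear f" and pf: "proper_on M f" and fM: "f ` M \<subseteq> M"
  shows "proper_on M (f ^^ n)"
proof (induction n)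
  case 0
  then show ?case
    unfolding proper_on_def by (auto intro!: exI[of _ id] strict_mono_id)
next
  case (Suc n)
  show ?case
    using proper_on_comp[OF f pf fM Suc] by (simp only: funpow_Suc_right o_def)
qed

text \<open>On a bounded sequence the values of \<open>g\<close> are bounded in a finite-dimensional
  space, so they converge along a subsequence; there the values of \<open>f\<close> converge
  too.\<close>

lemma proper_on_finite_rank_add:
  fixes f g :: "'a::complex_normed_vector \<Rightarrow> 'a"
  assumes p: "proper_on M f" and g: "bounded_linear g" and B: "finite B" "range g \<subseteq> cvs.span B"
  shows "proper_on M (\<lambda>x. f x + g x)"
  unfolding proper_on_def
proof (intro allI impI)
  fix x y assume x: "range x \<subseteq> M" "bounded (range x)" "(\<lambda>n. f (x n) + g (x n)) \<longlonglongrightarrow> y"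
  have "bounded (range (\<lambda>n. g (x n)))"
    using bounded_linear_image[OF x(2) g] by (simp add: image_image)
  then obtain l r where r: "strict_mono (r :: nat \<Rightarrow> nat)" and l: "(\<lambda>n. g (x (r n))) \<longlonglongrightarrow> l"
    using bounded_cspan_finite_subseq[OF B(1), of "\<lambda>n. g (x n)"] B(2) by blast
  have "(\<lambda>n. (f (x (r n)) + g (x (r n))) - g (x (r n))) \<longlonglongrightarrow> y - l"
    using LIMSEQ_subseq_LIMSEQ[OF x(3) r] l by (intro tendsto_diff) (auto simp: o_def)
  then have lim: "(\<lambda>n. f (x (r n))) \<longlonglongrightarrow> y - l"
    by simp
  have "bounded (range (\<lambda>n. x (r n)))"
    by (rule bounded_subset[OF x(2)]) auto
  moreover have "x (r n) \<in> M" for n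
    using x(1) by blast
  ultimately obtain k s where "strict_mono (s :: nat \<Rightarrow> nat)" "(\<lambda>n. x (r (s n))) \<longlonglongrightarrow> k"
    using proper_onD[OF p _ _ lim] by metis
  then show "\<exists>l r. strict_mono (r :: nat \<Rightarrow> nat) \<and> (\<lambda>n. x (r n)) \<longlonglongrightarrow> l"
    using strict_mono_o[OF r] by (intro exI[of _ k] exI[of _ "r \<circ> s"]) simp
qed

section \<open>Kernels and ranges of powers\<close>

definition ker_dim :: "('a::complex_vector \<Rightarrow> 'a) \<Rightarrow> nat \<Rightarrow> enat" where
  "ker_dim S n = reldim (null_space S \<inter> range (S ^^ n)) {0}"

definition ran_codim :: "('a::complex_vector \<Rightarrow> 'a) \<Rightarrow> nat \<Rightarrow> enat" where
  "ran_codim S n = reldim (range (S ^^ n)) (range (S ^^ Suc n))"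

lemma clinear_funpow:
  fixes S :: "'a::complex_vector \<Rightarrow> 'a"
  shows "clinear S \<Longrightarrow> clinear (S ^^ n)"
proof (induction n)
  case 0
  show ?case
    by (simp add: Vector_Spaces.linear_iff cvs.vector_space_axioms)
next
  case (Suc n)
  then show ?case
    using Vector_Spaces.linear_compose[of "(*\<^sub>C)" "(*\<^sub>C)" "S ^^ n" "(*\<^sub>C)" S] by (simp add: o_def)
qed

lemma subspace_range: "clinear S \<Longrightarrow> cvs.subspace (range S)"
  by (rule cvs_pair.linear_subspace_image) simp_all

lemma range_funpow_Suc: "range (S ^^ Suc n) = S ` range (S ^^ n)"
  by (simp add: image_comp)

lemma range_funpow_antimono: "m \<le> n \<Longrightarrow> range (S ^^ n) \<subseteq> range (S ^^ m)"
  for S :: "'a \<Rightarrow> 'a"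
  by (auto simp: le_iff_add funpow_add)

text \<open>The common drop \<open>g\<close> is the dimension of \<open>N(S) \<inter> R(S^n)\<close>
  over \<open>N(S) \<inter> R(S^(n+1))\<close>. For \<open>ran_codim\<close> this is the kernel term
  when \<open>S\<close> maps \<open>R(S^n)\<close> and \<open>R(S^(n+1))\<close> onto the next
  ranges. The additive form stays meaningful when dimensions are infinite.\<close>

lemma ker_dim_ran_codim_Suc:
  assumes S: "clinear S"
  obtains g where "ker_dim S n = ker_dim S (Suc n) + g" "ran_codim S n = ran_codim S (Suc n) + g"
proof -
  let ?N = "null_space S" and ?R = "\<lambda>n. range (S ^^ n)"
  have R: "cvs.subspace (?R n)" for n
    by (intro subspace_range clinear_funpow S)
  have mono: "?R (Suc n) \<subseteq> ?R n"
    by (rule range_funpow_antimono) simp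
  have N: "cvs.subspace (?N \<inter> ?R n)" for n
    by (intro cvs.subspace_inter subspace_null_space S R)
  have "ker_dim S n = ker_dim S (Suc n) + reldim (?N \<inter> ?R n) (?N \<inter> ?R (Suc n))"
    unfolding ker_dim_def
    by (subst add.commute, rule reldim_additive) (use N mono cvs.subspace_0[OF N] in \<open>auto simp del: funpow.simps\<close>)
  moreover have "ran_codim S n = ran_codim S (Suc n) + reldim (?N \<inter> ?R n) (?N \<inter> ?R (Suc n))"
    unfolding ran_codim_def range_funpow_Suc[of "Suc n" S]
    using reldim_image_null_space[OF S R R mono] range_funpow_Suc[of n S] by (simp only:)
  ultimately show thesis
    using that by blast
qed

lemma ker_dim_ran_codim_le:
  assumes S: "clinear S" and "n \<le> n'"
  shows "\<exists>g. ker_dim S n = ker_dim S n' + g \<and> ran_codim S n = ran_codim S n' + g"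
  using \<open>n \<le> n'\<close>
proof (induction n' rule: dec_induct)
  case base
  show ?case
    by (rule exI[of _ 0]) simp
next
  case (step m)
  then obtain g where g: "ker_dim S n = ker_dim S m + g" "ran_codim S n = ran_codim S m + g"
    by blast
  obtain h where "ker_dim S m = ker_dim S (Suc m) + h" "ran_codim S m = ran_codim S (Suc m) + h"
    using ker_dim_ran_codim_Suc[OF S] by blast
  with g show ?case
    by (intro exI[of _ "h + g"]) (simp add: add.assoc)
qed

lemma ker_dim_antimono: "clinear S \<Longrightarrow> n \<le> n' \<Longrightarrow> ker_dim S n' \<le> ker_dim S n"
  using ker_dim_ran_codim_le by (metis le_iff_add)

lemma ran_codim_antimono: "clinear S \<Longrightarrow> n \<le> n' \<Longrightarrow> ran_codim S n' \<le> ran_codim S n"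
  using ker_dim_ran_codim_le by (metis le_iff_add)

text \<open>\<open>S\<close> maps \<open>N(S^(k+1)) \<inter> R(S^d)\<close> onto
  \<open>N(S^k) \<inter> R(S^(d+1))\<close>, with kernel \<open>N(S) \<inter> R(S^d)\<close>.
  Iteration gives a sum of \<open>k\<close> consecutive terms of \<open>ker_dim\<close>.\<close>

lemma reldim_null_space_funpow_Suc:
  assumes S: "clinear S"
  shows "reldim (null_space (S ^^ Suc k) \<inter> range (S ^^ d)) {0}
    = ker_dim S d + reldim (null_space (S ^^ k) \<inter> range (S ^^ Suc d)) {0}"
proof -
  let ?V = "null_space (S ^^ Suc k) \<inter> range (S ^^ d)"
  have V: "cvs.subspace ?V"
    by (intro cvs.subspace_inter subspace_null_space subspace_range clinear_funpow S)
  have Vimg: "S ` ?V = null_space (S ^^ k) \<inter> range (S ^^ Suc d)"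
  proof
    show "S ` ?V \<subseteq> null_space (S ^^ k) \<inter> range (S ^^ Suc d)"
      by (auto simp: null_space_def funpow_swap1)
    show "null_space (S ^^ k) \<inter> range (S ^^ Suc d) \<subseteq> S ` ?V"
    proof
      fix y assume "y \<in> null_space (S ^^ k) \<inter> range (S ^^ Suc d)"
      then obtain x where "y = S ((S ^^ d) x)" "(S ^^ k) y = 0"
        by (auto simp: null_space_def)
      then show "y \<in> S ` ?V"
        by (intro image_eqI[of _ _ "(S ^^ d) x"]) (auto simp: null_space_def funpow_swap1)
    qed
  qed
  have "S ^^ k \<circ> S = S ^^ Suc k"
    by (simp add: funpow_Suc_right del: funpow.simps)
  then have Vker: "null_space S \<inter> ?V = null_space S \<inter> range (S ^^ d)"
    unfolding null_space_def using cvs_pair.linear_0[OF clinear_funpow[OF S]]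
    by (auto simp: fun_eq_iff simp del: funpow.simps) (metis)
  have 0: "S ` {0} = {0}" "null_space S \<inter> {0} = {0}"
    using cvs_pair.linear_0[OF S] by (auto simp: null_space_def)
  have "reldim ?V {0} = reldim (S ` ?V) (S ` {0}) + reldim (null_space S \<inter> ?V) (null_space S \<inter> {0})"
    by (rule reldim_image_null_space[OF S V]) (use cvs.subspace_0[OF V] in auto)
  then show ?thesis
    unfolding Vimg Vker 0 ker_dim_def by (simp add: add.commute)
qed

lemma reldim_null_space_funpow_ge:
  assumes S: "clinear S" and p: "\<And>n. p \<le> ker_dim S n"
  shows "of_nat k * p \<le> reldim (null_space (S ^^ k) \<inter> range (S ^^ d)) {0}"
proof (induction k arbitrary: d)
  case (Suc k)
  have "of_nat (Suc k) * p = p + of_nat k * p"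
    by (simp add: distrib_right)
  also have "\<dots> \<le> ker_dim S d + reldim (null_space (S ^^ k) \<inter> range (S ^^ Suc d)) {0}"
    by (intro add_mono p Suc)
  finally show ?case
    by (simp only: reldim_null_space_funpow_Suc[OF S])
qed simp

lemma reldim_null_space_funpow_le:
  assumes S: "clinear S"
  shows "reldim (null_space (S ^^ k) \<inter> range (S ^^ d)) {0} \<le> of_nat k * ker_dim S d"
proof (induction k arbitrary: d)
  case 0
  show ?case
    by (simp add: reldim_eq_0 null_space_def)
next
  case (Suc k)
  have "ker_dim S d + reldim (null_space (S ^^ k) \<inter> range (S ^^ Suc d)) {0}
    \<le> ker_dim S d + of_nat k * ker_dim S (Suc d)"
    by (intro add_left_mono Suc)
  also have "\<dots> \<le> ker_dim S d + of_nat k * ker_dim S d"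
    by (intro add_left_mono mult_left_mono ker_dim_antimono S) auto
  also have "\<dots> = of_nat (Suc k) * ker_dim S d"
    by (simp add: distrib_right)
  finally show ?case
    by (simp only: reldim_null_space_funpow_Suc[OF S])
qed

lemma reldim_range_funpow_Suc:
  assumes S: "clinear S"
  shows "reldim (range (S ^^ d)) (range (S ^^ (d + Suc k)))
    = ran_codim S d + reldim (range (S ^^ Suc d)) (range (S ^^ (Suc d + k)))"
  unfolding ran_codim_def add_Suc_shift[symmetric]
  by (intro reldim_additive subspace_range clinear_funpow S range_funpow_antimono) simp_all

lemma reldim_range_funpow_ge:
  assumes S: "clinear S" and p: "\<And>n. p \<le> ran_codim S n"
  shows "of_nat k * p \<le> reldim (range (S ^^ d)) (range (S ^^ (d + k)))"
proof (induction k arbitrary: d)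
  case (Suc k)
  have "of_nat (Suc k) * p = p + of_nat k * p"
    by (simp add: distrib_right)
  also have "\<dots> \<le> ran_codim S d + reldim (range (S ^^ Suc d)) (range (S ^^ (Suc d + k)))"
    by (intro add_mono p Suc)
  finally show ?case
    by (simp only: reldim_range_funpow_Suc[OF S])
qed simp

lemma reldim_range_funpow_le:
  assumes S: "clinear S"
  shows "reldim (range (S ^^ d)) (range (S ^^ (d + k))) \<le> of_nat k * ran_codim S d"
proof (induction k arbitrary: d)
  case 0
  show ?case
    by (simp add: reldim_eq_0 cvs.span_superset)
next
  case (Suc k)
  have "ran_codim S d + reldim (range (S ^^ Suc d)) (range (S ^^ (Suc d + k)))
    \<le> ran_codim S d + of_nat k * ran_codim S (Suc d)"
    by (intro add_left_mono Suc)
  also have "\<dots> \<le> ran_codim S d + of_nat k * ran_codim S d"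
    by (intro add_left_mono mult_left_mono ran_codim_antimono S) auto
  also have "\<dots> = of_nat (Suc k) * ran_codim S d"
    by (simp add: distrib_right)
  finally show ?case
    by (simp only: reldim_range_funpow_Suc[OF S])
qed

text \<open>Both sides grow linearly in \<open>k\<close>, so the slopes compare. This removes the
  bounded error terms that comparing \<open>S\<close> and \<open>U\<close> produces.\<close>

lemma enat_le_of_linear_growth:
  fixes p q r :: enat
  assumes "\<And>k. of_nat k * p \<le> of_nat (k + m) * q + r" and "r \<noteq> \<infinity>"
  shows "p \<le> q"
proof (cases q)
  case (enat q')
  obtain r' where r': "r = enat r'"
    using assms(2) by auto
  have "p \<noteq> \<infinity>"
    using assms(1)[of 1] enat r' by (cases p) (auto simp: of_nat_eq_enat)
  then obtain p' where p': "p = enat p'"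
    by auto
  have ineq: "k * p' \<le> (k + m) * q' + r'" for k
    using assms(1)[of k] by (simp add: enat r' p' of_nat_eq_enat)
  have "p' \<le> q'"
  proof (rule ccontr)
    assume "\<not> p' \<le> q'"
    \<comment> \<open>The value \<open>k = m * q' + r' + 1\<close> just exceeds the constant error
      \<open>m * q' + r'\<close>, so a slope of at least \<open>q' + 1\<close> is
      impossible.\<close>
    then have "(m * q' + r' + 1) * (q' + 1) \<le> (m * q' + r' + 1) * p'"
      by (intro mult_left_mono) auto
    also have "\<dots> \<le> (m * q' + r' + 1 + m) * q' + r'"
      by (rule ineq)
    finally show False
      by (simp add: algebra_simps)
  qed
  then show ?thesis
    using enat p' by simp
qed auto

section \<open>Algebraic comparison of a commuting perturbation with the original operator\<close>

locale commuting_pair =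
  fixes S F :: "'a::complex_vector \<Rightarrow> 'a"
  assumes S: "clinear S" and F: "clinear F" and commute: "S (F x) = F (S x)"
begin

abbreviation U :: "'a \<Rightarrow> 'a" where "U \<equiv> \<lambda>x. S x + F x"

lemma clinear_U: "clinear U"
  using S F by (rule cvs_pair.linear_compose_add)

lemma commute_funpow: "S ((F ^^ m) x) = (F ^^ m) (S x)" "F ((S ^^ m) x) = (S ^^ m) (F x)"
  by (induction m) (simp_all add: commute commute[symmetric])

text \<open>In the expansion of \<open>(S + F)^(d+m)\<close> every monomial has at least
  \<open>d\<close> factors \<open>S\<close> or at least \<open>m\<close> factors \<open>F\<close>.
  The induction avoids binomial sums: one factor is split off, and the remaining exponent is read as
  \<open>(d-1) + m\<close> before applying \<open>S\<close> and as \<open>d + (m-1)\<close> before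
  applying \<open>F\<close>.\<close>

lemma funpow_U_decomp: "\<exists>y z. (U ^^ (d + m)) x = (S ^^ d) y + (F ^^ m) z"
proof (induction "d + m" arbitrary: d m x)
  case 0
  then show ?case
    by (auto intro: exI[of _ x] exI[of _ 0])
next
  case (Suc n)
  consider "d = 0" | "m = 0" | d' m' where "d = Suc d'" "m = Suc m'"
    by (metis old.nat.exhaust)
  then show ?case
  proof cases
    case 1
    then show ?thesis
      using cvs_pair.linear_0[OF clinear_funpow[OF F]]
      by (intro exI[of _ "(U ^^ (d + m)) x"] exI[of _ 0]) simp
  next
    case 2
    then show ?thesis
      using cvs_pair.linear_0[OF clinear_funpow[OF S]]
      by (intro exI[of _ 0] exI[of _ "(U ^^ (d + m)) x"]) simp
  next
    case 3
    obtain y1 z1 where 1: "(U ^^ n) x = (S ^^ d') y1 + (F ^^ m) z1"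
      using Suc.hyps(1)[of d' m x] Suc.hyps(2) 3 by auto
    obtain y2 z2 where 2: "(U ^^ n) x = (S ^^ d) y2 + (F ^^ m') z2"
      using Suc.hyps(1)[of d m' x] Suc.hyps(2) 3 by auto
    have "(U ^^ (d + m)) x = S ((U ^^ n) x) + F ((U ^^ n) x)"
      using Suc.hyps(2) by (metis funpow.simps(2) o_apply)
    also have "S ((U ^^ n) x) = (S ^^ d) y1 + (F ^^ m) (S z1)"
      unfolding 1 by (simp add: cvs_pair.linear_add[OF S] commute_funpow 3(1))
    also have "F ((U ^^ n) x) = (S ^^ d) (F y2) + (F ^^ m) z2"
      unfolding 2 by (simp add: cvs_pair.linear_add[OF F] commute_funpow 3(2))
    finally have "(U ^^ (d + m)) x = (S ^^ d) (y1 + F y2) + (F ^^ m) (S z1 + z2)"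
      by (simp add: cvs_pair.linear_add[OF clinear_funpow[OF S]]
          cvs_pair.linear_add[OF clinear_funpow[OF F]] add_ac)
    then show ?thesis
      by blast
  qed
qed

text \<open>In the expansion of \<open>(U - F)^(k+m)\<close> at \<open>x\<close>, monomials with at
  least \<open>k\<close> factors \<open>U\<close> vanish and the others contain \<open>F^m\<close>.
  The induction splits off one factor: \<open>U x\<close> is killed by \<open>U^(k-1)\<close>, and
  for \<open>F\<close> the exponent \<open>m\<close> is lowered instead.\<close>

lemma funpow_S_null_space: "(U ^^ k) x = 0 \<Longrightarrow> (S ^^ (k + m)) x \<in> range (F ^^ m)"
proof (induction "k + m" arbitrary: k m x)
  case 0
  then show ?case
    by simp
next
  case (Suc n)
  consider "k = 0" | "m = 0" | k' m' where "k = Suc k'" "m = Suc m'"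
    by (metis old.nat.exhaust)
  then show ?case
  proof cases
    case 1
    then show ?thesis
      using Suc.prems cvs_pair.linear_0[OF clinear_funpow[OF S]] cvs_pair.linear_0[OF clinear_funpow[OF F]]
      by (auto intro: range_eqI[of _ _ 0])
  next
    case 3
    have "(U ^^ k') (U x) = 0"
      using Suc.prems 3(1) funpow_swap1[of U k' x] by simp
    then have 1: "(S ^^ n) (U x) \<in> range (F ^^ m)"
      using Suc.hyps(1)[of k' m "U x"] Suc.hyps(2) 3(1) by simp
    have "(S ^^ n) x \<in> range (F ^^ m')"
      using Suc.hyps(1)[of k m' x] Suc.hyps(2) Suc.prems 3 by simp
    then have 2: "F ((S ^^ n) x) \<in> range (F ^^ m)"
      using 3 by auto
    have "(S ^^ (k + m)) x = (S ^^ n) (S x)"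
      using Suc.hyps(2) by (metis funpow_swap1 funpow.simps(2) o_apply)
    also have "S x = U x - F x"
      by simp
    also have "(S ^^ n) \<dots> = (S ^^ n) (U x) - F ((S ^^ n) x)"
      by (simp only: cvs_pair.linear_diff[OF clinear_funpow[OF S]] commute_funpow)
    also have "\<dots> \<in> range (F ^^ m)"
      using 1 2 by (intro cvs.subspace_diff subspace_range clinear_funpow F)
    finally show ?thesis .
  qed simp
qed

end

locale finite_rank_commuting_pair = commuting_pair +
  fixes m :: nat and B :: "'a set"
  assumes B: "finite B" "range (F ^^ m) \<subseteq> cvs.span B"
begin

lemma range_U: "range (U ^^ (d + m)) \<subseteq> cvs.span (range (S ^^ d) \<union> B)"
proof
  fix w assume "w \<in> range (U ^^ (d + m))"
  then obtain y z where w: "w = (S ^^ d) y + (F ^^ m) z"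
    using funpow_U_decomp by blast
  have "(F ^^ m) z \<in> cvs.span (range (S ^^ d) \<union> B)"
    using B(2) cvs.span_mono[of B "range (S ^^ d) \<union> B"] by blast
  then show "w \<in> cvs.span (range (S ^^ d) \<union> B)"
    unfolding w by (intro cvs.span_add) (auto intro: cvs.span_base)
qed

text \<open>Inside the kernel taken in \<open>M + span B\<close>, the part lying in \<open>M\<close>
  has codimension at most \<open>card B\<close>.\<close>

lemma reldim_null_space_inter_span:
  assumes "clinear g" and M: "cvs.subspace M"
  shows "reldim (null_space g \<inter> cvs.span (M \<union> B)) {0} \<le> reldim (null_space g \<inter> M) {0} + enat (card B)"
proof -
  let ?V = "null_space g \<inter> cvs.span (M \<union> B)"
  have "reldim ?V {0} \<le> reldim ?V (?V \<inter> M) + reldim (?V \<inter> M) {0}"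
    by (rule reldim_triangle)
  also have "reldim ?V (?V \<inter> M) = reldim ?V M"
    using assms by (intro reldim_Int cvs.subspace_inter subspace_null_space) auto
  also have "\<dots> \<le> enat (card B)"
    by (rule reldim_le_card) (use B in auto)
  also have "?V \<inter> M = null_space g \<inter> M"
    by (auto intro: cvs.span_base)
  finally show ?thesis
    by (simp add: add.commute add_right_mono)
qed

lemma ker_dim_perturb: "(INF n. ker_dim U n) \<le> ker_dim S d"
proof (rule enat_le_of_linear_growth)
  fix k
  define g where "g = S ^^ (k + m)"
  define M where "M = range (S ^^ d)"
  \<comment> \<open>\<open>Z\<close> contains \<open>N(U^k) \<inter> R(U^(d+m))\<close> but is
    described through \<open>S\<close> and \<open>B\<close> alone. Under \<open>g\<close> its image
    lies in the span of \<open>B\<close>, and its kernel is that of \<open>S^(k+m)\<close> in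
    \<open>M + span B\<close>.\<close>
  define Z where "Z = cvs.span (M \<union> B) \<inter> g -` cvs.span B"
  have g: "clinear g" and M: "cvs.subspace M"
    unfolding g_def M_def by (intro clinear_funpow subspace_range S)+
  have Z: "cvs.subspace Z"
    unfolding Z_def by (intro cvs.subspace_inter cvs_pair.linear_subspace_vimage g) auto
  have "of_nat k * (INF n. ker_dim U n) \<le> reldim (null_space (U ^^ k) \<inter> range (U ^^ (d + m))) {0}"
    by (rule reldim_null_space_funpow_ge[OF clinear_U]) (auto intro: INF_lower)
  also have "\<dots> \<le> reldim Z {0}"
    using range_U[of d] subsetD[OF B(2) funpow_S_null_space[of k _ m]]
    unfolding Z_def M_def g_def null_space_def by (intro reldim_mono) auto
  also have "\<dots> = reldim (g ` Z) (g ` {0}) + reldim (null_space g \<inter> Z) (null_space g \<inter> {0})"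
    by (rule reldim_image_null_space[OF g Z]) (use cvs.subspace_0[OF Z] in auto)
  also have "\<dots> \<le> enat (card B) + (reldim (null_space g \<inter> M) {0} + enat (card B))"
  proof (rule add_mono)
    show "reldim (g ` Z) (g ` {0}) \<le> enat (card B)"
      using B(1) cvs.span_mono[of B "g ` {0} \<union> B"] unfolding Z_def by (intro reldim_le_card) auto
    have "reldim (null_space g \<inter> Z) (null_space g \<inter> {0}) \<le> reldim (null_space g \<inter> cvs.span (M \<union> B)) {0}"
      using cvs_pair.linear_0[OF g] by (intro reldim_mono) (auto simp: Z_def null_space_def)
    also have "\<dots> \<le> reldim (null_space g \<inter> M) {0} + enat (card B)"
      by (rule reldim_null_space_inter_span[OF g M])
    finally show "reldim (null_space g \<inter> Z) (null_space g \<inter> {0}) \<le> reldim (null_space g \<inter> M) {0} + enat (card B)" .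
  qed
  also have "\<dots> \<le> enat (card B) + (of_nat (k + m) * ker_dim S d + enat (card B))"
    unfolding g_def M_def by (intro add_left_mono add_right_mono reldim_null_space_funpow_le S)
  also have "\<dots> = of_nat (k + m) * ker_dim S d + enat (card B + card B)"
    by (simp add: ac_simps flip: plus_enat_simps(1))
  finally show "of_nat k * (INF n. ker_dim U n) \<le> of_nat (k + m) * ker_dim S d + enat (card B + card B)" .
qed simp

text \<open>Since \<open>S = U + (- F)\<close> and powers of \<open>- F\<close> agree with those of
  \<open>F\<close> up to sign, every estimate below can also be used with \<open>S\<close> and
  \<open>U\<close> interchanged.\<close>

lemma inverse_pair: "finite_rank_commuting_pair U (\<lambda>x. - F x) m B"
proof -
  have pow: "((\<lambda>x. - F x) ^^ n) x = (if even n then (F ^^ n) x else - (F ^^ n) x)" for n x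
    by (induction n arbitrary: x) (auto simp: cvs_pair.linear_neg[OF F])
  show ?thesis
  proof (intro finite_rank_commuting_pair.intro commuting_pair.intro finite_rank_commuting_pair_axioms.intro)
    show "range ((\<lambda>x. - F x) ^^ m) \<subseteq> cvs.span B"
      using B(2) by (auto simp: pow image_subset_iff cvs.span_neg)
    show "S (- F x) + F (- F x) = - F (S x + F x)" for x
      by (simp add: commute cvs_pair.linear_add[OF F] cvs_pair.linear_neg[OF S] cvs_pair.linear_neg[OF F])
  qed (use clinear_U cvs_pair.linear_compose_neg[OF F] B(1) in auto)
qed

lemma range_S: "range (S ^^ (d + m)) \<subseteq> cvs.span (range (U ^^ d) \<union> B)"
  using finite_rank_commuting_pair.range_U[OF inverse_pair] by simp

text \<open>The comparison runs from \<open>R(U^(d+m))\<close> through \<open>R(S^d)\<close> and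
  \<open>R(S^(d+m+k+m))\<close> to \<open>R(U^(d+m+k))\<close>. Each change between \<open>U\<close>
  and \<open>S\<close> shifts the exponent by \<open>m\<close> and costs at most
  \<open>card B\<close> dimensions, which explains the shift \<open>m + m\<close>.\<close>

lemma ran_codim_perturb: "(INF n. ran_codim U n) \<le> ran_codim S d"
proof (rule enat_le_of_linear_growth)
  fix k
  let ?RS = "\<lambda>n. range (S ^^ n)" and ?RU = "\<lambda>n. range (U ^^ n)"
  have "of_nat k * (INF n. ran_codim U n) \<le> reldim (?RU (d + m)) (?RU (d + m + k))"
    by (rule reldim_range_funpow_ge[OF clinear_U]) (auto intro: INF_lower)
  also have "\<dots> \<le> reldim (?RU (d + m)) (?RS d) + reldim (?RS d) (?RU (d + m + k))"
    by (rule reldim_triangle)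
  also have "\<dots> \<le> enat (card B) + (reldim (?RS d) (?RS (d + m + k + m)) + reldim (?RS (d + m + k + m)) (?RU (d + m + k)))"
    by (intro add_mono reldim_triangle reldim_le_card B range_U)
  also have "\<dots> \<le> enat (card B) + (of_nat (m + k + m) * ran_codim S d + enat (card B))"
    using reldim_range_funpow_le[OF S, of d "m + k + m"]
    by (intro add_mono reldim_le_card B range_S) (auto simp: add.assoc)
  also have "\<dots> = of_nat (k + (m + m)) * ran_codim S d + enat (card B + card B)"
    by (simp add: ac_simps flip: plus_enat_simps(1))
  finally show "of_nat k * (INF n. ran_codim U n) \<le> of_nat (k + (m + m)) * ran_codim S d + enat (card B + card B)" .
qed simp

lemma INF_ker_dim_perturb: "(INF n. ker_dim U n) = (INF n. ker_dim S n)"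
  using ker_dim_perturb finite_rank_commuting_pair.ker_dim_perturb[OF inverse_pair] by (intro antisym INF_greatest) auto

lemma INF_ran_codim_perturb: "(INF n. ran_codim U n) = (INF n. ran_codim S n)"
  using ran_codim_perturb finite_rank_commuting_pair.ran_codim_perturb[OF inverse_pair] by (intro antisym INF_greatest) auto

end

section \<open>Semi-B-Weyl operators\<close>

lemma bounded_clinear_op_funpow:
  assumes "bounded_clinear_op f"
  shows "bounded_clinear_op (f ^^ n)"
proof -
  have "bounded_linear (f ^^ n)"
  proof (induction n)
    case 0
    show ?case
      using bounded_linear_ident by simp
  next
    case (Suc n)
    then show ?case
      using bounded_linear_compose[of f "f ^^ n"] assms by (simp add: o_def bounded_clinear_op_def)
  qed
  then show ?thesis
    using assms by (simp add: bounded_clinear_op_def clinear_funpow)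
qed

locale bounded_finite_rank_commuting_pair = finite_rank_commuting_pair S F m B
  for S F :: "'a::complex_banach \<Rightarrow> 'a" and m B +
  assumes bounded_S: "bounded_clinear_op S" and bounded_F: "bounded_clinear_op F"
begin

lemma bounded_U: "bounded_clinear_op U"
  using bounded_S bounded_F clinear_U by (auto simp: bounded_clinear_op_def intro: bounded_linear_add)

lemma inverse_bounded: "bounded_finite_rank_commuting_pair U (\<lambda>x. - F x) m B"
proof (intro bounded_finite_rank_commuting_pair.intro bounded_finite_rank_commuting_pair_axioms.intro)
  show "bounded_clinear_op (\<lambda>x. - F x)"
    using bounded_F cvs_pair.linear_compose_neg[OF F]
    by (auto simp: bounded_clinear_op_def intro: bounded_linear_minus)
qed (rule inverse_pair bounded_U)+

text \<open>With \<open>G = - F\<close> one has \<open>U = S - G\<close>, and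
  \<open>S^(j+1) - G^(j+1) = S (S^j - G^j) + G^j (S - G)\<close>. So the quotient for
  \<open>j + 1\<close> is \<open>S v + G^j\<close>, where \<open>v\<close> is the one for
  \<open>j\<close>.\<close>

lemma U_divides_power_diff:
  "\<exists>v. bounded_linear v \<and> (\<forall>x. v (U x) = (S ^^ j) x - ((\<lambda>x. - F x) ^^ j) x)"
proof (induction j)
  case 0
  show ?case
    by (rule exI[of _ "\<lambda>_. 0"]) simp
next
  case (Suc j)
  let ?G = "\<lambda>x. - F x"
  interpret inv: bounded_finite_rank_commuting_pair U ?G m B
    by (rule inverse_bounded)
  obtain v where v: "bounded_linear v" "\<And>x. v (U x) = (S ^^ j) x - (?G ^^ j) x"
    using Suc by blast
  have "bounded_linear (\<lambda>x. S (v x) + (?G ^^ j) x)"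
    by (rule bounded_linear_add[OF bounded_linear_compose[OF _ v(1)]])
       (use bounded_S bounded_clinear_op_funpow[OF inv.bounded_F, of j] in \<open>simp_all add: bounded_clinear_op_def\<close>)
  moreover have "S (v (U x)) + (?G ^^ j) (U x) = (S ^^ Suc j) x - (?G ^^ Suc j) x" for x
  proof -
    have "(?G ^^ j) (U x) = S ((?G ^^ j) x) + F ((?G ^^ j) x)"
      by (rule inv.commute_funpow(1)[symmetric])
    then show ?thesis
      by (simp add: v(2) cvs_pair.linear_diff[OF S])
  qed
  ultimately show ?case
    by (intro exI[of _ "\<lambda>x. S (v x) + (?G ^^ j) x"]) blast
qed

lemma U_commute_funpow_S: "U ((S ^^ n) x) = (S ^^ n) (U x)"
  by (simp only: commute_funpow(2) funpow_swap1 cvs_pair.linear_add[OF clinear_funpow[OF S]])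

lemma funpow_U_commute_funpow_S: "(U ^^ c) ((S ^^ n) x) = (S ^^ n) ((U ^^ c) x)"
proof (induction c)
  case (Suc c)
  then show ?case
    using U_commute_funpow_S[of n "(U ^^ c) x"] by simp
qed simp

lemma closed_range_U_of_upper:
  assumes n: "closed (range (S ^^ n))" "closed (range (S ^^ Suc n))" "ker_dim S n \<noteq> \<infinity>"
    and c: "c \<ge> n + m"
  shows "closed (range (U ^^ c))"
proof -
  define M where "M = range (S ^^ n)"
  let ?W = "cvs.span (M \<union> B)"
  have M: "cvs.subspace M" "closed M"
    unfolding M_def using n(1) by (auto intro: subspace_range clinear_funpow S)
  have rM: "subspace M"
    by (rule csubspace_imp_subspace[OF M(1)])
  have bS: "bounded_linear S" and bU: "bounded_linear U"
    using bounded_S bounded_U by (auto simp: bounded_clinear_op_def)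
  have SM: "S ` M \<subseteq> M" and SM_closed: "closed (S ` M)"
    unfolding M_def range_funpow_Suc[symmetric] using n(2) by (auto intro!: range_funpow_antimono simp del: funpow.simps)
  have UM: "U ` M \<subseteq> M"
    unfolding M_def using U_commute_funpow_S by auto
  obtain H where H: "finite H" "null_space S \<inter> M \<subseteq> cvs.span ({0} \<union> H)"
    using n(3) reldim_witness unfolding ker_dim_def M_def by metis
  have "proper_on M S"
    by (rule upper_sf_imp_proper_on[OF bounded_S M SM_closed H(1)]) (use H(2) in simp)
  then have "proper_on M (S ^^ m)"
    by (rule proper_on_funpow[OF bS _ SM])
  have "proper_on M U"
  proof -
    interpret inv: bounded_finite_rank_commuting_pair U "\<lambda>x. - F x" m B
      by (rule inverse_bounded)
    \<comment> \<open>\<open>?g\<close> is the finite rank summand for which \<open>S^m + ?g\<close>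
      equals \<open>v U\<close>, so properness of \<open>S^m\<close> on \<open>M\<close> reaches
      \<open>U\<close>.\<close>
    let ?g = "\<lambda>x. - ((\<lambda>x. - F x) ^^ m) x"
    have "bounded_linear ?g"
      using bounded_clinear_op_funpow[OF inv.bounded_F, of m]
      by (intro bounded_linear_minus) (auto simp: bounded_clinear_op_def)
    moreover have "range ?g \<subseteq> cvs.span B"
      using inv.B(2) by (auto intro!: cvs.span_neg)
    ultimately have "proper_on M (\<lambda>x. (S ^^ m) x + ?g x)"
      using \<open>proper_on M (S ^^ m)\<close> B(1) by (intro proper_on_finite_rank_add)
    moreover obtain v where v: "bounded_linear v" "\<And>x. v (U x) = (S ^^ m) x - ((\<lambda>x. - F x) ^^ m) x"
      using U_divides_power_diff by blast
    ultimately have "proper_on M (\<lambda>x. v (U x))"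
      by simp
    then show ?thesis
      by (rule proper_on_of_comp[OF v(1)])
  qed
  then have "proper_on M (U ^^ c)"
    by (rule proper_on_funpow[OF bU _ UM])
  then have UcM: "closed ((U ^^ c) ` M)"
    using bounded_clinear_op_funpow[OF bounded_U] rM M(2)
    by (intro proper_on_imp_closed_image) (auto simp: bounded_clinear_op_def)
  \<comment> \<open>As \<open>U^c\<close> and \<open>S^n\<close> commute, \<open>P\<close> equals
    \<open>R(U^c) + N(S^n)\<close>. The kernel may be infinite-dimensional; intersecting with
    \<open>?W\<close> leaves only the finite-dimensional part \<open>N\<close> of it.\<close>
  define P where "P = (S ^^ n) -` ((U ^^ c) ` M)"
  have linSn: "clinear (S ^^ n)" and linUc: "clinear (U ^^ c)"
    by (rule clinear_funpow S clinear_U)+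
  have P: "closed P" "cvs.subspace P"
  proof -
    have "continuous_on UNIV (S ^^ n)"
      using bounded_clinear_op_funpow[OF bounded_S]
      by (auto simp: bounded_clinear_op_def intro: linear_continuous_on)
    then show "closed P"
      unfolding P_def using continuous_on_closed_vimage[OF closed_UNIV] UcM by (metis Int_UNIV_right)
    show "cvs.subspace P"
      unfolding P_def
      by (intro cvs_pair.linear_subspace_vimage cvs_pair.linear_subspace_image linSn linUc M)
  qed
  define N where "N = null_space (S ^^ n) \<inter> ?W"
  have N: "cvs.subspace N"
    unfolding N_def by (intro cvs.subspace_inter subspace_null_space linSn cvs.subspace_span)
  have "reldim N {0} \<le> of_nat n * ker_dim S n + enat (card B)"
    unfolding N_def M_def
    by (rule order_trans[OF reldim_null_space_inter_span[OF linSn M(1)[unfolded M_def]]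
          add_right_mono[OF reldim_null_space_funpow_le[OF S]]])
  also have "\<dots> < \<infinity>"
    using n(3) by (cases "ker_dim S n") (auto simp: of_nat_eq_enat)
  finally have "reldim N {0} \<noteq> \<infinity>"
    by simp
  then obtain H' where H': "finite H'" "H' \<subseteq> N" "N \<subseteq> cvs.span ((N \<inter> {0}) \<union> H')"
    "reldim N {0} = enat (card H')"
    by (rule reldim_inside[OF N cvs.subspace_single_0])
  have NH': "N \<subseteq> cvs.span H'"
    using H'(3) cvs.subspace_0[OF N] by simp
  \<comment> \<open>Here \<open>c \<ge> n + m\<close> is used: it places the range of
    \<open>U^c\<close> inside \<open>M + span B\<close>.\<close>
  have A: "range (U ^^ c) \<subseteq> ?W"
    using range_funpow_antimono[OF c, of U] range_U[of n] unfolding M_def by blast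
  have "cvs.span (range (U ^^ c) \<union> H') = P \<inter> ?W"
  proof
    have "range (U ^^ c) \<subseteq> P"
      unfolding P_def M_def using funpow_U_commute_funpow_S by (auto simp: image_iff)
    moreover have "N \<subseteq> P"
      using cvs_pair.linear_0[OF linUc] cvs.subspace_0[OF M(1)] unfolding N_def P_def null_space_def
      by (force simp: image_iff)
    ultimately show "cvs.span (range (U ^^ c) \<union> H') \<subseteq> P \<inter> ?W"
      using A H'(2) P(2) by (intro cvs.span_minimal cvs.subspace_inter) (auto simp: N_def)
    show "P \<inter> ?W \<subseteq> cvs.span (range (U ^^ c) \<union> H')"
    proof
      fix x assume x: "x \<in> P \<inter> ?W"
      then obtain y where y: "(S ^^ n) x = (S ^^ n) ((U ^^ c) y)"
        unfolding P_def M_def using funpow_U_commute_funpow_S by auto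
      have "x - (U ^^ c) y \<in> ?W"
        using x A by (intro cvs.span_diff) auto
      then have "x - (U ^^ c) y \<in> N"
        unfolding N_def null_space_def using y by (simp add: cvs_pair.linear_diff[OF linSn])
      then have "x - (U ^^ c) y \<in> cvs.span (range (U ^^ c) \<union> H')"
        using NH' cvs.span_mono[of H' "range (U ^^ c) \<union> H'"] by blast
      then show "x \<in> cvs.span (range (U ^^ c) \<union> H')"
        using cvs.span_add[of "x - (U ^^ c) y" _ "(U ^^ c) y"] by (auto intro: cvs.span_base)
    qed
  qed
  moreover have "closed (P \<inter> ?W)"
    using P(1) closed_span_Un_finite[OF B(1) M(2,1)] by (rule closed_Int)
  ultimately show ?thesis
    using closed_range_of_closed_span[OF bounded_clinear_op_funpow[OF bounded_U] H'(1)] by simp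
qed

text \<open>\<open>R(S^(c+m))\<close> has finite codimension in \<open>R(S^n)\<close> and lies in
  \<open>R(U^c) + span B\<close>, while \<open>c \<ge> n + m\<close> puts \<open>R(U^c)\<close> into
  \<open>R(S^n) + span B\<close>. Hence adding \<open>H \<union> B\<close> to either range yields
  the same space, which is closed because \<open>R(S^n)\<close> is.\<close>

lemma closed_range_U_of_lower:
  assumes n: "closed (range (S ^^ n))" "ran_codim S n \<noteq> \<infinity>" and c: "c \<ge> n + m"
  shows "closed (range (U ^^ c))"
proof -
  let ?M = "range (S ^^ n)" and ?A = "range (U ^^ c)"
  define k where "k = c + m - n"
  have k: "c + m = n + k"
    using c by (simp add: k_def)
  have "reldim ?M ?A \<le> reldim ?M (range (S ^^ (c + m))) + reldim (range (S ^^ (c + m))) ?A"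
    by (rule reldim_triangle)
  also have "\<dots> \<le> of_nat k * ran_codim S n + enat (card B)"
    using reldim_range_funpow_le[OF S, of n k] unfolding k[symmetric]
    by (intro add_mono reldim_le_card B range_S)
  also have "\<dots> < \<infinity>"
    using n(2) by (cases "ran_codim S n") (auto simp: of_nat_eq_enat)
  finally obtain H where H: "finite H" "?M \<subseteq> cvs.span (?A \<union> H)"
    using reldim_witness[of ?M ?A] by auto
  have A: "?A \<subseteq> cvs.span (?M \<union> B)"
    using range_funpow_antimono[OF c, of U] range_U[of n] by blast
  have "cvs.span (?A \<union> (H \<union> B)) = cvs.span (?M \<union> (H \<union> B))"
  proof
    show "cvs.span (?A \<union> (H \<union> B)) \<subseteq> cvs.span (?M \<union> (H \<union> B))"
      using A cvs.span_mono[of "?M \<union> B" "?M \<union> (H \<union> B)"]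
      by (intro cvs.span_minimal) (auto intro: cvs.span_base)
    show "cvs.span (?M \<union> (H \<union> B)) \<subseteq> cvs.span (?A \<union> (H \<union> B))"
      using H(2) cvs.span_mono[of "?A \<union> H" "?A \<union> (H \<union> B)"]
      by (intro cvs.span_minimal) (auto intro: cvs.span_base)
  qed
  moreover have "closed (cvs.span (?M \<union> (H \<union> B)))"
    using H(1) B(1) n(1) by (intro closed_span_Un_finite subspace_range clinear_funpow S) auto
  ultimately show ?thesis
    using closed_range_of_closed_span[OF bounded_clinear_op_funpow[OF bounded_U], of "H \<union> B"] H(1) B(1)
    by simp
qed

end

section \<open>Semi-B-Weyl conditions in terms of the two sequences\<close>

lemma ereal_of_enat_diff_le_0:
  "a < \<infinity> \<and> ereal_of_enat a - ereal_of_enat b \<le> 0 \<longleftrightarrow> a \<noteq> \<infinity> \<and> a \<le> b"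
  \<comment> \<open>Finiteness of \<open>a\<close> excludes a difference of two infinities, so the
    sign of the difference reflects the order.\<close>
  by (cases a; cases b) auto

lemma ereal_of_enat_diff_ge_0:
  "b < \<infinity> \<and> 0 \<le> ereal_of_enat a - ereal_of_enat b \<longleftrightarrow> b \<noteq> \<infinity> \<and> b \<le> a"
  by (cases a; cases b) auto

lemma ereal_of_enat_diff_eq_0:
  "a < \<infinity> \<and> b < \<infinity> \<and> ereal_of_enat a - ereal_of_enat b = 0 \<longleftrightarrow> a \<noteq> \<infinity> \<and> a = b"
  by (cases a; cases b) auto

text \<open>The extended naturals are well-ordered, so the infimum is attained, and a decreasing
  sequence stays there.\<close>

lemma eventually_INF_antimono:
  fixes f :: "nat \<Rightarrow> enat"
  assumes "\<And>n n'. n \<le> n' \<Longrightarrow> f n' \<le> f n"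
  shows "\<exists>N. \<forall>n\<ge>N. f n = (INF n. f n)"
proof -
  have "(INF n. f n) \<in> range f"
    unfolding Inf_enat_def using LeastI[of "\<lambda>x. x \<in> range f" "f 0"] by simp
  then obtain N where "(INF n. f n) = f N"
    by blast
  then have "f n = (INF n. f n)" if "n \<ge> N" for n
    using assms[OF that] INF_lower[of n UNIV f] by auto
  then show ?thesis
    by blast
qed

context
  fixes S :: "'a::complex_normed_vector \<Rightarrow> 'a"
  assumes S: "clinear S"
begin

lemma index_on_range_funpow:
  "index_on (range (S ^^ n)) S = ereal_of_enat (ker_dim S n) - ereal_of_enat (ran_codim S n)"
  "edim (null_space S \<inter> range (S ^^ n)) = ker_dim S n"
  "ecodim (range (S ^^ n)) (S ` range (S ^^ n)) = ran_codim S n"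
proof -
  show 1: "edim (null_space S \<inter> range (S ^^ n)) = ker_dim S n"
    unfolding ker_dim_def
    by (intro edim_eq_reldim cvs.subspace_inter subspace_null_space subspace_range clinear_funpow S)
  show 2: "ecodim (range (S ^^ n)) (S ` range (S ^^ n)) = ran_codim S n"
    unfolding ran_codim_def range_funpow_Suc[symmetric]
    by (intro ecodim_eq_reldim subspace_range clinear_funpow S range_funpow_antimono) simp
  show "index_on (range (S ^^ n)) S = ereal_of_enat (ker_dim S n) - ereal_of_enat (ran_codim S n)"
    unfolding index_on_def 1 2 ..
qed

text \<open>Closedness of the range of the restriction becomes closedness of the range of the next
  power, so only ranges of powers and the two sequences remain.\<close>

lemma upper_semi_B_weyl_iff:
  "upper_semi_B_weyl S \<longleftrightarrow> (\<exists>n. closed (range (S ^^ n)) \<and> closed (range (S ^^ Suc n))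
     \<and> ker_dim S n \<noteq> \<infinity> \<and> ker_dim S n \<le> ran_codim S n)"
  unfolding upper_semi_B_weyl_def upper_sf_on_def index_on_range_funpow range_funpow_Suc
  unfolding ereal_of_enat_diff_le_0[symmetric] conj_assoc ..

lemma lower_semi_B_weyl_iff:
  "lower_semi_B_weyl S \<longleftrightarrow> (\<exists>n. closed (range (S ^^ n)) \<and> closed (range (S ^^ Suc n))
     \<and> ran_codim S n \<noteq> \<infinity> \<and> ran_codim S n \<le> ker_dim S n)"
  unfolding lower_semi_B_weyl_def lower_sf_on_def index_on_range_funpow range_funpow_Suc
  unfolding ereal_of_enat_diff_ge_0[symmetric] conj_assoc ..

lemma B_weyl_iff:
  "B_weyl S \<longleftrightarrow> (\<exists>n. closed (range (S ^^ n)) \<and> closed (range (S ^^ Suc n))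
     \<and> ker_dim S n \<noteq> \<infinity> \<and> ker_dim S n = ran_codim S n)"
  unfolding B_weyl_def fredholm_on_def upper_sf_on_def lower_sf_on_def index_on_range_funpow range_funpow_Suc
  unfolding ereal_of_enat_diff_eq_0[symmetric] by blast

lemma eventually_stable:
  obtains N where "\<And>n. n \<ge> N \<Longrightarrow> ker_dim S n = (INF n. ker_dim S n)"
    "\<And>n. n \<ge> N \<Longrightarrow> ran_codim S n = (INF n. ran_codim S n)"
proof -
  obtain N1 N2 where "\<forall>n\<ge>N1. ker_dim S n = (INF n. ker_dim S n)" "\<forall>n\<ge>N2. ran_codim S n = (INF n. ran_codim S n)"
    using eventually_INF_antimono[of "ker_dim S"] eventually_INF_antimono[of "ran_codim S"]
      ker_dim_antimono[OF S] ran_codim_antimono[OF S] by metis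
  then show thesis
    by (intro that[of "max N1 N2"]) auto
qed

text \<open>Comparing \<open>n\<close> with a later index at which both sequences are stable shows
  that they lie above their limits by the same amount.\<close>

lemma INF_ker_dim_ran_codim:
  obtains g where "ker_dim S n = (INF n. ker_dim S n) + g" "ran_codim S n = (INF n. ran_codim S n) + g"
proof -
  obtain N where N: "\<And>n. n \<ge> N \<Longrightarrow> ker_dim S n = (INF n. ker_dim S n)"
    "\<And>n. n \<ge> N \<Longrightarrow> ran_codim S n = (INF n. ran_codim S n)"
    using eventually_stable by blast
  show thesis
    using ker_dim_ran_codim_le[OF S, of n "max n N"] N[of "max n N"] that by auto
qed

text \<open>Finiteness of \<open>ker_dim S n\<close> makes the common drop \<open>g\<close> finite,
  so it cancels from the inequality.\<close>

lemma INF_le_of_upper: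
  assumes "ker_dim S n \<noteq> \<infinity>" "ker_dim S n \<le> ran_codim S n"
  shows "(INF n. ker_dim S n) \<noteq> \<infinity> \<and> (INF n. ker_dim S n) \<le> (INF n. ran_codim S n)"
proof -
  obtain g where g: "ker_dim S n = (INF n. ker_dim S n) + g" "ran_codim S n = (INF n. ran_codim S n) + g"
    by (rule INF_ker_dim_ran_codim)
  show ?thesis
    using assms unfolding g by (cases g; cases "INF n. ker_dim S n"; cases "INF n. ran_codim S n") auto
qed

lemma INF_le_of_lower:
  assumes "ran_codim S n \<noteq> \<infinity>" "ran_codim S n \<le> ker_dim S n"
  shows "(INF n. ran_codim S n) \<noteq> \<infinity> \<and> (INF n. ran_codim S n) \<le> (INF n. ker_dim S n)"
proof -
  obtain g where g: "ker_dim S n = (INF n. ker_dim S n) + g" "ran_codim S n = (INF n. ran_codim S n) + g"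
    by (rule INF_ker_dim_ran_codim)
  show ?thesis
    using assms unfolding g by (cases g; cases "INF n. ker_dim S n"; cases "INF n. ran_codim S n") auto
qed

text \<open>One index at which the ranges are closed and the limits are attained suffices to read
  off the semi-B-Weyl property from the limits.\<close>

lemma eventually_closed_stable:
  assumes "\<And>n. n \<ge> n0 \<Longrightarrow> closed (range (S ^^ n))"
  obtains n where "closed (range (S ^^ n))" "closed (range (S ^^ Suc n))"
    "ker_dim S n = (INF n. ker_dim S n)" "ran_codim S n = (INF n. ran_codim S n)"
proof -
  obtain N where N: "\<And>n. n \<ge> N \<Longrightarrow> ker_dim S n = (INF n. ker_dim S n)"
    "\<And>n. n \<ge> N \<Longrightarrow> ran_codim S n = (INF n. ran_codim S n)"
    using eventually_stable by blast
  show thesis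
    by (rule that[of "max n0 N"]) (intro assms N; simp)+
qed

end

section \<open>Transfer of the properties to the perturbed operator\<close>

context bounded_finite_rank_commuting_pair
begin

lemma upper_semi_B_weyl_perturb:
  assumes "upper_semi_B_weyl S"
  shows "upper_semi_B_weyl U"
proof -
  obtain n where n: "closed (range (S ^^ n))" "closed (range (S ^^ Suc n))"
    "ker_dim S n \<noteq> \<infinity>" "ker_dim S n \<le> ran_codim S n"
    using assms upper_semi_B_weyl_iff[OF S] by blast
  obtain k where k: "closed (range (U ^^ k))" "closed (range (U ^^ Suc k))"
    "ker_dim U k = (INF n. ker_dim U n)" "ran_codim U k = (INF n. ran_codim U n)"
    using eventually_closed_stable[OF clinear_U closed_range_U_of_upper[OF n(1-3)]] by blast
  \<comment> \<open>At the stable index \<open>k\<close> the condition concerns only the limits,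
    which \<open>U\<close> shares with \<open>S\<close>.\<close>
  have "ker_dim U k \<noteq> \<infinity> \<and> ker_dim U k \<le> ran_codim U k"
    unfolding k(3,4) INF_ker_dim_perturb INF_ran_codim_perturb by (rule INF_le_of_upper[OF S n(3,4)])
  with k(1,2) show ?thesis
    unfolding upper_semi_B_weyl_iff[OF clinear_U] by blast
qed

lemma lower_semi_B_weyl_perturb:
  assumes "lower_semi_B_weyl S"
  shows "lower_semi_B_weyl U"
proof -
  obtain n where n: "closed (range (S ^^ n))" "ran_codim S n \<noteq> \<infinity>" "ran_codim S n \<le> ker_dim S n"
    using assms lower_semi_B_weyl_iff[OF S] by blast
  obtain k where k: "closed (range (U ^^ k))" "closed (range (U ^^ Suc k))"
    "ker_dim U k = (INF n. ker_dim U n)" "ran_codim U k = (INF n. ran_codim U n)"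
    using eventually_closed_stable[OF clinear_U closed_range_U_of_lower[OF n(1,2)]] by blast
  have "ran_codim U k \<noteq> \<infinity> \<and> ran_codim U k \<le> ker_dim U k"
    unfolding k(3,4) INF_ker_dim_perturb INF_ran_codim_perturb by (rule INF_le_of_lower[OF S n(2,3)])
  with k(1,2) show ?thesis
    unfolding lower_semi_B_weyl_iff[OF clinear_U] by blast
qed

lemma B_weyl_perturb:
  assumes "B_weyl S"
  shows "B_weyl U"
proof -
  obtain n where n: "closed (range (S ^^ n))" "ker_dim S n \<noteq> \<infinity>" "ker_dim S n = ran_codim S n"
    using assms B_weyl_iff[OF S] by blast
  \<comment> \<open>The equality makes the codimension finite as well, so closedness of the ranges
    follows as in the lower case.\<close>
  then have fin: "ran_codim S n \<noteq> \<infinity>"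
    by simp
  obtain k where k: "closed (range (U ^^ k))" "closed (range (U ^^ Suc k))"
    "ker_dim U k = (INF n. ker_dim U n)" "ran_codim U k = (INF n. ran_codim U n)"
    using eventually_closed_stable[OF clinear_U closed_range_U_of_lower[OF n(1) fin]] by blast
  have "ker_dim U k \<noteq> \<infinity> \<and> ker_dim U k = ran_codim U k"
    unfolding k(3,4) INF_ker_dim_perturb INF_ran_codim_perturb
    using INF_le_of_upper[OF S n(2)] INF_le_of_lower[OF S fin] n(3) by auto
  with k(1,2) show ?thesis
    unfolding B_weyl_iff[OF clinear_U] by blast
qed

lemma semi_B_weyl_perturb_iff:
  "upper_semi_B_weyl U \<longleftrightarrow> upper_semi_B_weyl S"
  "lower_semi_B_weyl U \<longleftrightarrow> lower_semi_B_weyl S"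
  "B_weyl U \<longleftrightarrow> B_weyl S"
proof -
  interpret inv: bounded_finite_rank_commuting_pair U "\<lambda>x. - F x" m B
    by (rule inverse_bounded)
  show "upper_semi_B_weyl U \<longleftrightarrow> upper_semi_B_weyl S"
    using upper_semi_B_weyl_perturb inv.upper_semi_B_weyl_perturb by auto
  show "lower_semi_B_weyl U \<longleftrightarrow> lower_semi_B_weyl S"
    using lower_semi_B_weyl_perturb inv.lower_semi_B_weyl_perturb by auto
  show "B_weyl U \<longleftrightarrow> B_weyl S"
    using B_weyl_perturb inv.B_weyl_perturb by auto
qed

end

theorem theorem2p16:
  fixes T F :: "'a::complex_banach \<Rightarrow> 'a"
  assumes "\<not> cfinite_dim (UNIV :: 'a set)"
    and "bounded_clinear_op T"
    and "bounded_clinear_op F"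
    and "\<exists>n. cfinite_dim (range (F ^^ n))"
    and "T \<circ> F = F \<circ> T"
  shows "sigma_USBW (\<lambda>x. T x + F x) = sigma_USBW T
    \<and> sigma_LSBW (\<lambda>x. T x + F x) = sigma_LSBW T
    \<and> sigma_SBW (\<lambda>x. T x + F x) = sigma_SBW T
    \<and> sigma_BW (\<lambda>x. T x + F x) = sigma_BW T"
proof -
  obtain m B where B: "finite B" "range (F ^^ m) \<subseteq> cvs.span B"
    using assms(4) unfolding cfinite_dim_def by blast
  have T: "clinear T" and F: "clinear F"
    using assms(2,3) by (auto simp: bounded_clinear_op_def)
  have comm: "T (F x) = F (T x)" for x
    using assms(5) by (metis comp_apply)
  have shift: "shift_op (\<lambda>x. T x + F x) c = (\<lambda>x. shift_op T c x + F x)" for c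
    by (auto simp: shift_op_def)
  \<comment> \<open>Subtracting a scalar preserves boundedness and commutation with
    \<open>F\<close>, so the perturbation result applies at every \<open>c\<close> with the same
    \<open>m\<close> and \<open>B\<close>.\<close>
  have "bounded_finite_rank_commuting_pair (shift_op T c) F m B" for c
  proof (intro bounded_finite_rank_commuting_pair.intro bounded_finite_rank_commuting_pair_axioms.intro
      finite_rank_commuting_pair.intro finite_rank_commuting_pair_axioms.intro commuting_pair.intro)
    show lin: "clinear (shift_op T c)"
      unfolding shift_op_def
      by (intro cvs_pair.linear_compose_sub T cvs.linear_scale_self)
    show "bounded_clinear_op (shift_op T c)"
      using lin assms(2) bounded_bilinear.bounded_linear_right[OF bounded_bilinear_scaleC, of c]
      unfolding bounded_clinear_op_def shift_op_def by (auto intro: bounded_linear_sub)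
    show "shift_op T c (F x) = F (shift_op T c x)" for x
      by (simp add: shift_op_def comm cvs_pair.linear_diff[OF F] cvs_pair.linear_scale[OF F])
  qed (use F B assms(3) in auto)
  \<comment> \<open>Three equivalences yield all four spectra, since semi-B-Weyl is the disjunction
    of the upper and lower properties.\<close>
  note iffs = bounded_finite_rank_commuting_pair.semi_B_weyl_perturb_iff[OF this, folded shift]
  show ?thesis
    unfolding sigma_USBW_def sigma_LSBW_def sigma_SBW_def sigma_BW_def semi_B_weyl_def iffs by simp
qed

end
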